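(* Let $\mathcal X$ be a finite set and let $R,S$ be non-empty subsets of the set $\mathcal S(\mathcal X)$ of probability density functions on $\mathcal X$, with closed convex hulls $\overline{\mathrm{co}}(R)$, $\overline{\mathrm{co}}(S)$. Let $(\mathrm e,E)$ be any of the pairs $(\mathrm s,D)$ (Stein exponent, relative entropy), $(\mathrm c,C)$ (Chernoff exponent, Chernoff divergence), $(\mathrm d_r,H_r)$ with $r>0$ (direct exponent, Hoeffding divergence). Then \begin{align*} E(\overline{\mathrm{co}}(R)\|\overline{\mathrm{co}}(S)) &=\inf_{\rho\in\overline{\mathrm{co}}(R),\,\sigma\in\overline{\mathrm{co}}(S)}\mathrm e(\rho\|\sigma)\\ &\le\mathrm e^{\mathrm{adv}}(\overline{\mathrm{co}}(R)\|\overline{\mathrm{co}}(S))\le\mathrm e^{\mathrm{adv}}(R\|S)\\ &\le\mathrm e^{\mathrm{av}}(R\|S)=\mathrm e^{\mathrm{av}}(\overline{\mathrm{co}}(R)\|\overline{\mathrm{co}}(S))\\ &\le\mathrm e(\overline{\mathrm{co}}(R)\|\overline{\mathrm{co}}(S))\le\mathrm e^{\{x\}}(\overline{\mathrm{co}}(R)\|\overline{\mathrm{co}}(S))\le\mathrm e^{\{0,1\}}(\overline{\mathrm{co}}(R)\|\overline{\mathrm{co}}(S))\\ &\le\inf_{\rho\in\overline{\mathrm{co}}(R),\,\sigma\in\overline{\mathrm{co}}(S)}\mathrm e(\rho\|\sigma) \end{align*} for $x=0$ and for $x=1$, and hence all these inequalities hold as equalities.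
   Context: $\log$ is natural, $-\log0=+\infty$. Divergences for $\rho,\sigma\in\mathcal S(\mathcal X)$: $D(\rho\|\sigma)=\sum_x\rho(x)\log\frac{\rho(x)}{\sigma(x)}$ if $\operatorname{supp}\rho\subseteq\operatorname{supp}\sigma$ (with $0\log 0=0$), and $+\infty$ otherwise; $D_\alpha(\rho\|\sigma)=\frac1{\alpha-1}\log\sum_x\rho(x)^\alpha\sigma(x)^{1-\alpha}$, $\alpha\in(0,1)$; $C(\rho\|\sigma)=\sup_{\alpha\in(0,1)}(1-\alpha)D_\alpha(\rho\|\sigma)$; $H_r(\rho\|\sigma)=\sup_{\alpha\in(0,1)}\frac{\alpha-1}{\alpha}[r-D_\alpha(\rho\|\sigma)]$. For sets, $E(A\|B)=\inf_{\rho\in A,\sigma\in B}E(\rho\|\sigma)$. Hypotheses on $n$ samples. A test is a function $T_n:\mathcal X^n\to[0,1]$; $\omega(T_n)=\sum_{\underline x}\omega(\underline x)T_n(\underline x)$ for $\omega\in\mathcal S(\mathcal X^n)$. For sets $R_n,S_n\subseteq\mathcal S(\mathcal X^n)$ put $\alpha_n(T_n)=\sup_{\rho\in R_n}\rho(1-T_n)$, $\beta_n(T_n)=\sup_{\sigma\in S_n}\sigma(T_n)$. Given $A\subseteq\mathcal S(\mathcal X)$: - i.i.d.: $A^{\otimes n}=\{\rho^{\otimes n}:\rho\in A\}$; - arbitrarily varying: $A^{\otimes n}_{\mathrm{av}}=\{\rho_1\otimes\dots\otimes\rho_n:\rho_k\in A\}$; - adversarial: $A^{(n)}_{\mathrm{adv}}$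 is the set of $\rho\in\mathcal S(\mathcal X^n)$ whose first marginal $\rho_1$ is in $A$ and such that for all $k=1,\dots,n-1$ and all $(x_1,\dots,x_k)\in\mathcal X^k$ (of positive probability, so that the conditional distribution is defined) the conditional distribution $\rho_{k+1}(\cdot|x_1\dots x_k)$ of the $(k+1)$-th coordinate given the first $k$ is in $A$. For hypotheses $(R_n)_n$ vs. $(S_n)_n$: $\mathrm s$ is the supremum of all $r\ge0$ for which some test sequence satisfies $\liminf_n-\frac1n\log\beta_n(T_n)\ge r$ and $\lim_n\alpha_n(T_n)=0$; $\mathrm d_r$ is the supremum of all $r'\ge0$ for which some test sequence satisfies $\liminf_n-\frac1n\log\beta_n(T_n)\ge r$ and $\liminf_n-\frac1n\log\alpha_n(T_n)\ge r'$; $\mathrm c$ is the supremum of all $r\ge0$ for which some test sequence satisfies $\liminf_n-\frac1n\log\beta_n(T_n)\ge r$ and $\liminf_n-\frac1n\log\alpha_n(T_n)\ge r$. $\mathrm e(A\|B)$, $\mathrm e^{\mathrm{av}}(A\|B)$, $\mathrm e^{\mathrm{adv}}(A\|B)$ denote these for $(R_n,S_n)=(A^{\otimes n},B^{\otimes n})$, $(A^{\otimes n}_{\mathrm{av}},B^{\otimes n}_{\mathrm{av}})$, $(A^{(n)}_{\mathrm{adv}},B^{(n)}_{\mathrm{adv}})$, respectively, and $\mathrm e(\rho\|\sigma)=\mathrm e(\{\rho\}\|\{\sigma\})$. Relaxed i.i.d. exponents $\mathrm e^t(A\|B)$, $t\in\{\{0\},\{1\},\{0,1\}\}$: if $0\in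 t$, each asymptotic condition on $\alpha_n(T_n)$ is replaced by the same condition on $\rho^{\otimes n}(1-T_n)$ for every individual $\rho\in A$; if $1\in t$, each asymptotic condition on $\beta_n(T_n)$ is replaced by the same condition on $\sigma^{\otimes n}(T_n)$ for every individual $\sigma\in B$ (the test sequence being the same for all states).
   Formalization: The first equality, E of the hulls = inf e(ρ‖σ), is not claimed for (d_r, H_r) when r equals the infimum over both hulls of −log σ(supp ρ); there it is false (R={δ_0}, S={uniform on two points}, r=log 2: H_r=0 but d_r=+∞). *)

theory Defs
  imports "HOL-Analysis.Analysis"
begin

text \<open>The finite set is the finite type \<^typ>\<open>'a\<close>. Densities on it are vectors in \<^typ>\<open>real^'a\<close>, so
  that the closed convex hull of \<open>A\<close> is \<^term>\<open>closure (convex hull A)\<close>.\<close>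

definition states :: "(real^'a::finite) set" where
  "states = {\<rho>. (\<forall>x. 0 \<le> \<rho> $ x) \<and> (\<Sum>x\<in>UNIV. \<rho> $ x) = 1}"

definition supp :: "real^'a::finite \<Rightarrow> 'a set" where
  "supp \<rho> = {x. \<rho> $ x \<noteq> 0}"

definition elog :: "real \<Rightarrow> ereal" where
  "elog t = (if t = 0 then -\<infinity> else ereal (ln t))"

text \<open>Divergences. The term for \<open>\<rho> $ x = 0\<close> in the sum below vanishes, as it should.\<close>

definition relative_entropy :: "real^'a::finite \<Rightarrow> real^'a \<Rightarrow> ereal" where
  "relative_entropy \<rho> \<sigma> =
     (if supp \<rho> \<subseteq> supp \<sigma> then ereal (\<Sum>x\<in>UNIV. \<rho> $ x * ln (\<rho> $ x / \<sigma> $ x)) else \<infinity>)"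

definition renyi_div :: "real \<Rightarrow> real^'a::finite \<Rightarrow> real^'a \<Rightarrow> ereal" where
  "renyi_div \<alpha> \<rho> \<sigma> =
     ereal (1 / (\<alpha> - 1)) * elog (\<Sum>x\<in>UNIV. (\<rho> $ x) powr \<alpha> * (\<sigma> $ x) powr (1 - \<alpha>))"

definition chernoff_div :: "real^'a::finite \<Rightarrow> real^'a \<Rightarrow> ereal" where
  "chernoff_div \<rho> \<sigma> = (SUP \<alpha>\<in>{0<..<1}. ereal (1 - \<alpha>) * renyi_div \<alpha> \<rho> \<sigma>)"

definition hoeffding_div :: "real \<Rightarrow> real^'a::finite \<Rightarrow> real^'a \<Rightarrow> ereal" where
  "hoeffding_div r \<rho> \<sigma> =
     (SUP \<alpha>\<in>{0<..<1}. ereal ((\<alpha> - 1) / \<alpha>) * (ereal r - renyi_div \<alpha> \<rho> \<sigma>))"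

text \<open>The Renyi divergence of order 0, that is, the limit of \<open>renyi_div \<alpha> \<rho> \<sigma>\<close> for \<open>\<alpha> \<rightarrow> 0\<close>.
  For a given pair of densities, the direct exponent at \<open>r\<close> is the Hoeffding divergence for all
  \<open>r > 0\<close> except possibly \<open>r = renyi_div_0 \<rho> \<sigma>\<close>. There the test that accepts \<open>\<rho>\<close> iff
  all samples are in \<open>supp \<rho>\<close> has \<open>\<alpha>\<^sub>n = 0\<close> and \<open>\<beta>\<^sub>n = exp (- n r)\<close>, so that the
  direct exponent is infinite, while the Hoeffding divergence is finite. (Example: \<open>\<rho>\<close> a point
  mass, \<open>\<sigma>\<close> uniform on two points, \<open>r = ln 2\<close>; then \<open>hoeffding_div r \<rho> \<sigma> = 0\<close>.)\<close>

definition renyi_div_0 :: "real^'a::finite \<Rightarrow> real^'a \<Rightarrow> ereal" where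
  "renyi_div_0 \<rho> \<sigma> = - elog (\<Sum>x\<in>supp \<rho>. \<sigma> $ x)"

definition set_div ::
    "(real^'a::finite \<Rightarrow> real^'a \<Rightarrow> ereal) \<Rightarrow> (real^'a) set \<Rightarrow> (real^'a) set \<Rightarrow> ereal" where
  "set_div E A B = (INF \<rho>\<in>A. INF \<sigma>\<in>B. E \<rho> \<sigma>)"

text \<open>A point of the \<open>n\<close>-fold product is a list of length \<open>n\<close>. Densities and tests on
  the product are functions on all lists of which only the values on lists of length \<open>n\<close>
  matter.\<close>

definition seqs :: "nat \<Rightarrow> 'a list set" where
  "seqs n = {xs. length xs = n}"

definition states_n :: "nat \<Rightarrow> ('a::finite list \<Rightarrow> real) set" where
  "states_n n = {\<omega>. (\<forall>xs\<in>seqs n. 0 \<le> \<omega> xs) \<and> (\<Sum>xs\<in>seqs n. \<omega> xs) = 1}"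

definition test_seq :: "(nat \<Rightarrow> 'a list \<Rightarrow> real) \<Rightarrow> bool" where
  "test_seq T \<longleftrightarrow> (\<forall>n. \<forall>xs\<in>seqs n. T n xs \<in> {0..1})"

definition expect :: "nat \<Rightarrow> ('a::finite list \<Rightarrow> real) \<Rightarrow> ('a list \<Rightarrow> real) \<Rightarrow> real" where
  "expect n \<omega> f = (\<Sum>xs\<in>seqs n. \<omega> xs * f xs)"

type_synonym 'a hyp = "nat \<Rightarrow> ('a list \<Rightarrow> real) set"

definition err1 :: "'a::finite hyp \<Rightarrow> (nat \<Rightarrow> 'a list \<Rightarrow> real) \<Rightarrow> nat \<Rightarrow> real" where
  "err1 R T n = (SUP \<rho>\<in>R n. expect n \<rho> (\<lambda>xs. 1 - T n xs))"

definition err2 :: "'a::finite hyp \<Rightarrow> (nat \<Rightarrow> 'a list \<Rightarrow> real) \<Rightarrow> nat \<Rightarrow> real" where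
  "err2 S T n = (SUP \<sigma>\<in>S n. expect n \<sigma> (T n))"

definition rate :: "(nat \<Rightarrow> real) \<Rightarrow> ereal" where
  "rate a = liminf (\<lambda>n. ereal (- (1 / real n)) * elog (a n))"

definition prod_state :: "nat \<Rightarrow> (nat \<Rightarrow> real^'a::finite) \<Rightarrow> 'a list \<Rightarrow> real" where
  "prod_state n \<rho> xs = (\<Prod>i<n. \<rho> i $ (xs ! i))"

definition iid :: "(real^'a::finite) set \<Rightarrow> 'a hyp" where
  "iid A n = {prod_state n (\<lambda>_. \<rho>) | \<rho>. \<rho> \<in> A}"

definition av :: "(real^'a::finite) set \<Rightarrow> 'a hyp" where
  "av A n = {prod_state n \<rho> | \<rho>. \<forall>i<n. \<rho> i \<in> A}"

definition prefix_prob :: "nat \<Rightarrow> ('a::finite list \<Rightarrow> real) \<Rightarrow> 'a list \<Rightarrow> real" where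
  "prefix_prob n \<omega> xs = (\<Sum>ys | ys \<in> seqs n \<and> take (length xs) ys = xs. \<omega> ys)"

definition cond_dist :: "nat \<Rightarrow> ('a::finite list \<Rightarrow> real) \<Rightarrow> 'a list \<Rightarrow> real^'a" where
  "cond_dist n \<omega> xs = (\<chi> x. prefix_prob n \<omega> (xs @ [x]) / prefix_prob n \<omega> xs)"

text \<open>The first marginal only makes sense for \<open>n > 0\<close>; \<open>n = 0\<close> is irrelevant for the
  exponents.\<close>

definition adv :: "(real^'a::finite) set \<Rightarrow> 'a hyp" where
  "adv A n = {\<omega> \<in> states_n n.
     (\<chi> x. prefix_prob n \<omega> [x]) \<in> A \<and>
     (\<forall>k\<in>{1..<n}. \<forall>xs\<in>seqs k. 0 < prefix_prob n \<omega> xs \<longrightarrow> cond_dist n \<omega> xs \<in> A)}"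

text \<open>The exponents are defined for two families \<open>RR\<close>, \<open>SS\<close> of hypotheses: each asymptotic
  condition is imposed separately on every member of the family, with the same test sequence.
  One-element families give the exponents of a pair of hypotheses, and the families
  of all \<open>iid {\<rho>}\<close> give the relaxed exponents.\<close>

definition stein_exp :: "'a::finite hyp set \<Rightarrow> 'a hyp set \<Rightarrow> ereal" where
  "stein_exp RR SS = (SUP r\<in>{r::real. 0 \<le> r \<and> (\<exists>T. test_seq T \<and>
     (\<forall>S\<in>SS. ereal r \<le> rate (err2 S T)) \<and> (\<forall>R\<in>RR. err1 R T \<longlonglongrightarrow> 0))}. ereal r)"

definition direct_exp :: "real \<Rightarrow> 'a::finite hyp set \<Rightarrow> 'a hyp set \<Rightarrow> ereal" where
  "direct_exp r RR SS = (SUP r'\<in>{r'::real. 0 \<le> r' \<and> (\<exists>T. test_seq T \<and>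
     (\<forall>S\<in>SS. ereal r \<le> rate (err2 S T)) \<and> (\<forall>R\<in>RR. ereal r' \<le> rate (err1 R T)))}. ereal r')"

definition chernoff_exp :: "'a::finite hyp set \<Rightarrow> 'a hyp set \<Rightarrow> ereal" where
  "chernoff_exp RR SS = (SUP r\<in>{r::real. 0 \<le> r \<and> (\<exists>T. test_seq T \<and>
     (\<forall>S\<in>SS. ereal r \<le> rate (err2 S T)) \<and> (\<forall>R\<in>RR. ereal r \<le> rate (err1 R T)))}. ereal r)"

type_synonym 'a exponent = "'a hyp set \<Rightarrow> 'a hyp set \<Rightarrow> ereal"

definition e_iid :: "'a::finite exponent \<Rightarrow> (real^'a) set \<Rightarrow> (real^'a) set \<Rightarrow> ereal" where
  "e_iid e A B = e {iid A} {iid B}"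

definition e_av :: "'a::finite exponent \<Rightarrow> (real^'a) set \<Rightarrow> (real^'a) set \<Rightarrow> ereal" where
  "e_av e A B = e {av A} {av B}"

definition e_adv :: "'a::finite exponent \<Rightarrow> (real^'a) set \<Rightarrow> (real^'a) set \<Rightarrow> ereal" where
  "e_adv e A B = e {adv A} {adv B}"

definition e_simple :: "'a::finite exponent \<Rightarrow> real^'a \<Rightarrow> real^'a \<Rightarrow> ereal" where
  "e_simple e \<rho> \<sigma> = e_iid e {\<rho>} {\<sigma>}"

definition e_relaxed ::
    "nat set \<Rightarrow> 'a::finite exponent \<Rightarrow> (real^'a) set \<Rightarrow> (real^'a) set \<Rightarrow> ereal" where
  "e_relaxed t e A B =
     e (if 0 \<in> t then {iid {\<rho>} | \<rho>. \<rho> \<in> A} else {iid A})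
       (if 1 \<in> t then {iid {\<sigma>} | \<sigma>. \<sigma> \<in> B} else {iid B})"

end

theory Submission
  imports Defs
begin

text \<open>Write \<open>A = exp c \<rho>\<close>, \<open>B = exp r \<sigma>\<close> and \<open>Q\<^sub>a = \<Sum>x. A x powr a * B x powr (1 - a)\<close>.
  For all three divergences, \<open>E \<rho> \<sigma>\<close> exceeds a value iff \<open>Q\<^sub>a < 1\<close> for some
  \<open>0 < a < 1\<close>, with \<open>c = 0\<close> (Stein), \<open>c = r\<close> (Chernoff) or \<open>c\<close> the value and
  \<open>r\<close> fixed (Hoeffding); only one direction is needed for Stein. As \<open>Q\<^sub>a\<close> is convex in
  \<open>a\<close> and jointly concave in the densities, a minimax theorem makes \<open>a\<close> uniform on the
  hulls. The first-order conditions at a maximising pair then give a single likelihood weight whose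
  means are small for all densities of both hulls, and since a bound on a mean is inherited by
  conditional distributions, the corresponding likelihood test works against adversarial hypotheses.

  Conversely, no test can beat a pair \<open>\<rho>, \<sigma>\<close> if some third density \<open>\<tau>\<close> is
  closer to \<open>\<rho>\<close> and to \<open>\<sigma>\<close> in relative entropy than the two error rates: the tilted
  density at the order minimising \<open>Q\<^sub>a\<close> is such a \<open>\<tau>\<close>. The passage from the
  arbitrarily varying hypothesis of a set to that of its hull uses that expectations are affine in
  every factor of a product density.\<close>

section \<open>Affinity and minimax\<close>

text \<open>The order at which a pair has affinity below 1 depends on the pair, whereas an adversary
  may change densities after every sample; hence one order and one weight for all pairs are needed.
  Scaling by \<open>exp c\<close> and \<open>exp r\<close> absorbs the two error rates into the
  densities, so that all divergences and all likelihood tests share the threshold 1.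

  The converse needs affinity strictly above 1 on the closed interval of orders, but the divergences
  give only at least 1 on the open one. A slightly larger \<open>c\<close> makes this strict except
  at order 0, where only \<open>r\<close> acts, and \<open>r\<close> is fixed in the Hoeffding case.
  Equality at order 0 means \<open>ereal r = renyi_div_0 \<rho> \<sigma>\<close>. Either a mixed
  pair in the hulls escapes this, or \<open>r\<close> is the infimum of \<open>renyi_div_0\<close>
  over the hulls, and then a test that looks at supports only makes the exponents infinite. For
  Stein the third density is \<rho> itself, which is why one implication suffices there.\<close>

definition affinity :: "real \<Rightarrow> real^'a::finite \<Rightarrow> real^'a \<Rightarrow> real" where
  "affinity a A B = (\<Sum>x\<in>UNIV. (A $ x) powr a * (B $ x) powr (1 - a))"

lemma weighted_amgm:
  fixes x y t :: real
  assumes "0 \<le> x" "0 \<le> y" "0 < t" "t < 1"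
  shows "x powr t * y powr (1 - t) \<le> t * x + (1 - t) * y"
proof (cases "x = 0 \<or> y = 0")
  case True
  then show ?thesis using assms by auto
next
  case False
  then show ?thesis using assms Youngs_inequality_0[of t "1 - t" x y] by auto
qed

text \<open>Two-term Hoelder inequality. Divided by the right-hand side, each product on the left is
  by AM-GM at most a convex combination of its shares, such as \<open>a / (a + c)\<close> and
  \<open>b / (b + d)\<close>; the shares add up to 1.\<close>

lemma powr_mult_superadditive:
  fixes a b c d t :: real
  assumes "0 \<le> a" "0 \<le> b" "0 \<le> c" "0 \<le> d" "0 < t" "t < 1"
  shows "a powr t * b powr (1 - t) + c powr t * d powr (1 - t)
    \<le> (a + c) powr t * (b + d) powr (1 - t)"
proof (cases "a + c = 0 \<or> b + d = 0")
  case True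
  then have "a = 0 \<and> c = 0 \<or> b = 0 \<and> d = 0" using assms by linarith
  then show ?thesis by auto
next
  case False
  then have pos: "0 < a + c" "0 < b + d" using assms by auto
  let ?P = "(a + c) powr t * (b + d) powr (1 - t)"
  have eq: "u powr t * v powr (1 - t) = ?P * ((u / (a + c)) powr t * (v / (b + d)) powr (1 - t))"
    if "0 \<le> u" "0 \<le> v" for u v
    using that pos by (simp add: powr_divide)
  have bd: "u powr t * v powr (1 - t) \<le> ?P * (t * (u / (a + c)) + (1 - t) * (v / (b + d)))"
    if "0 \<le> u" "0 \<le> v" for u v
    unfolding eq[OF that]
    by (intro mult_left_mono weighted_amgm) (use that pos assms in auto)
  have "a powr t * b powr (1 - t) + c powr t * d powr (1 - t)
    \<le> ?P * (t * (a / (a + c)) + (1 - t) * (b / (b + d)))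
      + ?P * (t * (c / (a + c)) + (1 - t) * (d / (b + d)))"
    using bd[of a b] bd[of c d] assms by linarith
  also have "\<dots> = ?P * (t * ((a + c) / (a + c)) + (1 - t) * ((b + d) / (b + d)))"
    by (simp only: add_divide_distrib distrib_left distrib_right) 
  also have "\<dots> = ?P" using pos by simp
  finally show ?thesis .
qed

lemma affinity_nonneg: "0 \<le> affinity a A B"
  unfolding affinity_def by (intro sum_nonneg) auto

lemma affinity_scaleR:
  assumes "0 \<le> u" "0 \<le> v" "\<And>x. 0 \<le> A $ x" "\<And>x. 0 \<le> B $ x"
  shows "affinity a (u *\<^sub>R A) (v *\<^sub>R B) = u powr a * v powr (1 - a) * affinity a A B"
  using assms by (simp add: affinity_def powr_mult sum_distrib_left mult_ac)

lemma affinity_superadditive: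
  assumes "0 < a" "a < 1" "\<And>x. 0 \<le> A $ x" "\<And>x. 0 \<le> B $ x" "\<And>x. 0 \<le> C $ x" "\<And>x. 0 \<le> D $ x"
  shows "affinity a A B + affinity a C D \<le> affinity a (A + C) (B + D)"
  unfolding affinity_def sum.distrib[symmetric]
  by (rule sum_mono) (use assms powr_mult_superadditive in auto)

text \<open>Superadditivity plus homogeneity: the exponents \<open>a\<close> and
  \<open>1 - a\<close> sum to 1, so a common weight can be moved into both arguments.\<close>

lemma affinity_concave:
  assumes "0 < a" "a < 1" "0 \<le> u" "0 \<le> v" "u + v = 1"
    and "\<And>x. 0 \<le> A $ x" "\<And>x. 0 \<le> B $ x" "\<And>x. 0 \<le> C $ x" "\<And>x. 0 \<le> D $ x"
  shows "u * affinity a A B + v * affinity a C D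
    \<le> affinity a (u *\<^sub>R A + v *\<^sub>R C) (u *\<^sub>R B + v *\<^sub>R D)"
proof -
  have w: "w * affinity a X Y = affinity a (w *\<^sub>R X) (w *\<^sub>R Y)"
    if "0 \<le> w" "\<And>x. 0 \<le> X $ x" "\<And>x. 0 \<le> Y $ x" for w X Y
    using that affinity_scaleR[of w w X Y a]
    by (cases "w = 0") (auto simp: powr_add[symmetric])
  show ?thesis
    using assms affinity_superadditive[of a "u *\<^sub>R A" "u *\<^sub>R B" "v *\<^sub>R C" "v *\<^sub>R D"]
    by (simp add: w)
qed

text \<open>At the intermediate order every summand is the weighted geometric mean of the summands
  at \<open>s\<close> and \<open>t\<close>, so AM-GM applies.\<close>

lemma affinity_convex_order:
  assumes "0 < s" "s < 1" "0 \<le> u" "0 \<le> v" "u + v = 1" "0 < t" "t < 1"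
    and "\<And>x. 0 \<le> A $ x" "\<And>x. 0 \<le> B $ x"
  shows "affinity (u * s + v * t) A B \<le> u * affinity s A B + v * affinity t A B"
proof (cases "u = 0 \<or> v = 0")
  case True
  then show ?thesis using assms by auto
next
  case False
  then have uv: "0 < u" "u < 1" "v = 1 - u" using assms by auto
  have "(A $ x) powr (u * s + v * t) * (B $ x) powr (1 - (u * s + v * t))
     \<le> u * ((A $ x) powr s * (B $ x) powr (1 - s)) + v * ((A $ x) powr t * (B $ x) powr (1 - t))" for x
  proof -
    have e: "1 - (u * s + v * t) = (1 - s) * u + (1 - t) * (1 - u)" "u * s + v * t = s * u + t * (1 - u)"
      by (simp_all add: uv algebra_simps)
    have "(A $ x) powr (u * s + v * t) * (B $ x) powr (1 - (u * s + v * t))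
      = ((A $ x) powr s * (B $ x) powr (1 - s)) powr u * ((A $ x) powr t * (B $ x) powr (1 - t)) powr (1 - u)"
      unfolding e(1) by (simp add: e(2) powr_mult powr_powr powr_add)
    also have "\<dots> \<le> u * ((A $ x) powr s * (B $ x) powr (1 - s)) + (1 - u) * ((A $ x) powr t * (B $ x) powr (1 - t))"
      by (rule weighted_amgm) (use uv in auto)
    finally show ?thesis using uv by simp
  qed
  then show ?thesis
    unfolding affinity_def sum_distrib_left sum.distrib[symmetric] by (rule sum_mono)
qed

lemma continuous_on_affinity:
  assumes "0 < a" "a < 1" "continuous_on K f" "continuous_on K g"
    and "\<And>p x. p \<in> K \<Longrightarrow> 0 \<le> f p $ x" "\<And>p x. p \<in> K \<Longrightarrow> 0 \<le> g p $ x"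
  shows "continuous_on K (\<lambda>p. affinity a (f p) (g p))"
  unfolding affinity_def
  by (intro continuous_intros continuous_on_powr') (use assms in auto)

text \<open>The minimax step for two functions. By concavity the points \<open>(f p, g p)\<close>
  and all points below them form a convex set that misses a quadrant; the normal of a separating
  line, normalised, gives the weights.\<close>

lemma convex_combination_two_functions:
  fixes f g :: "'p::euclidean_space \<Rightarrow> real"
  assumes K: "compact K" "convex K" "K \<noteq> {}"
    and cont: "continuous_on K f" "continuous_on K g"
    and conc: "concave_on K f" "concave_on K g"
    and lt: "\<And>p. p \<in> K \<Longrightarrow> f p < c \<or> g p < c"
  obtains u v where "0 \<le> u" "0 \<le> v" "u + v = (1::real)" "\<And>p. p \<in> K \<Longrightarrow> u * f p + v * g p < c"
proof -
  have "continuous_on K (\<lambda>p. min (f p) (g p))" using cont by (intro continuous_intros)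
  then obtain p0 where p0: "p0 \<in> K" "\<And>p. p \<in> K \<Longrightarrow> min (f p) (g p) \<le> min (f p0) (g p0)"
    using continuous_attains_sup[of K "\<lambda>p. min (f p) (g p)"] K by blast
  \<comment> \<open>Separation is only weak, so the corner \<open>c'\<close> of the quadrant is put
    strictly between the maximum of \<open>min (f p) (g p)\<close> and \<open>c\<close>.\<close>
  define c' where "c' = (min (f p0) (g p0) + c) / 2"
  have c': "c' < c" "\<And>p. p \<in> K \<Longrightarrow> f p < c' \<or> g p < c'"
    using lt[OF p0(1)] p0(2) unfolding c'_def by (auto simp: min_def field_simps split: if_splits)
      (smt (verit))+
  define Z where "Z = {(x, y). \<exists>p\<in>K. x \<le> f p \<and> y \<le> g p}"
  have "convex Z"
  proof (rule convexI)
    fix z z' :: "real \<times> real" and u v :: real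
    assume zz: "z \<in> Z" "z' \<in> Z" and uv: "0 \<le> u" "0 \<le> v" "u + v = 1"
    obtain p where p: "p \<in> K" "fst z \<le> f p" "snd z \<le> g p" using zz(1) by (auto simp: Z_def)
    obtain p' where p': "p' \<in> K" "fst z' \<le> f p'" "snd z' \<le> g p'" using zz(2) by (auto simp: Z_def)
    have q: "u *\<^sub>R p + v *\<^sub>R p' \<in> K" using K(2) p p' uv by (auto simp: convex_def)
    have "u * f p + v * f p' \<le> f (u *\<^sub>R p + v *\<^sub>R p')"
      and "u * g p + v * g p' \<le> g (u *\<^sub>R p + v *\<^sub>R p')"
      using conc p p' uv by (auto simp: concave_on_iff)
    moreover have "u * fst z + v * fst z' \<le> u * f p + v * f p'"
      and "u * snd z + v * snd z' \<le> u * g p + v * g p'"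
      using p p' uv by (auto intro!: add_mono mult_left_mono)
    ultimately show "u *\<^sub>R z + v *\<^sub>R z' \<in> Z"
      using q by (auto simp: Z_def case_prod_beta intro!: bexI[of _ "u *\<^sub>R p + v *\<^sub>R p'"])
  qed
  moreover define W where "W = {c'..} \<times> {c'..}"
  have "convex W" unfolding W_def by (intro convex_Times) (auto simp: convex_real_interval)
  moreover have "Z \<noteq> {}" using K(3) by (auto simp: Z_def)
  moreover have "(c', c') \<in> W" by (simp add: W_def)
  moreover have "Z \<inter> W = {}" using c'(2) by (fastforce simp: Z_def W_def)
  ultimately obtain w b where w: "w \<noteq> 0" "\<forall>z\<in>Z. inner w z \<le> b" "\<forall>z\<in>W. b \<le> inner w z"
    using separating_hyperplane_sets[of Z W] by blast
  obtain w1 w2 where w12: "w = (w1, w2)" by fastforce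
  obtain p where p: "p \<in> K" using K(3) by auto
  have b: "b \<le> w1 * x + w2 * y" if "c' \<le> x" "c' \<le> y" for x y
    using w(3) that by (auto simp: W_def w12)
  have le: "w1 * f p + w2 * g p \<le> b" if "p \<in> K" for p
    using w(2) that by (auto simp: Z_def w12)
  have low: "w1 * x + w2 * y \<le> b" if "x \<le> f p" "y \<le> g p" for x y
    using w(2) that p by (auto simp: Z_def w12)
  \<comment> \<open>\<open>Z\<close> is unbounded downwards in each coordinate, so a negative
    component of the normal would make \<open>inner w\<close> unbounded above on
    \<open>Z\<close>.\<close>
  have w1: "0 \<le> w1"
  proof (rule ccontr)
    assume "\<not> 0 \<le> w1"
    define x where "x = min (f p) ((b - w2 * g p + 1) / w1)"
    have "x \<le> (b - w2 * g p + 1) / w1" unfolding x_def by linarith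
    then have "b - w2 * g p + 1 \<le> w1 * x" using \<open>\<not> 0 \<le> w1\<close> by (simp add: field_simps)
    moreover have "x \<le> f p" by (simp add: x_def)
    ultimately show False using low[of x "g p"] by simp
  qed
  have w2: "0 \<le> w2"
  proof (rule ccontr)
    assume "\<not> 0 \<le> w2"
    define x where "x = min (g p) ((b - w1 * f p + 1) / w2)"
    have "x \<le> (b - w1 * f p + 1) / w2" unfolding x_def by linarith
    then have "b - w1 * f p + 1 \<le> w2 * x" using \<open>\<not> 0 \<le> w2\<close> by (simp add: field_simps)
    moreover have "x \<le> g p" by (simp add: x_def)
    ultimately show False using low[of "f p" x] by simp
  qed
  have s: "0 < w1 + w2" using w(1) w1 w2 by (auto simp: w12 zero_prod_def)
  show thesis
  proof (rule that[of "w1 / (w1 + w2)" "w2 / (w1 + w2)"])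
    fix q assume "q \<in> K"
    have "w1 * f q + w2 * g q \<le> (w1 + w2) * c'"
      using le[OF \<open>q \<in> K\<close>] b[of c' c'] by (simp add: algebra_simps)
    also have "\<dots> < (w1 + w2) * c" using s c'(1) by simp
    finally show "w1 / (w1 + w2) * f q + w2 / (w1 + w2) * g q < c"
      using s by (simp add: add_divide_distrib[symmetric] pos_divide_less_eq mult.commute)
  qed (use w1 w2 s in \<open>auto simp: add_divide_distrib[symmetric]\<close>)
qed

text \<open>Induction on \<open>F\<close>, with \<open>K\<close> varying inside the fixed
  \<open>L\<close>. The induction hypothesis is used on the part of \<open>K\<close> where the new
  order \<open>a\<close> fails, which is convex by concavity of \<open>f a\<close>. It gives one
  order \<open>b\<close> there; the two-function case mixes \<open>f a\<close> and
  \<open>f b\<close> on all of \<open>K\<close>, and convexity in the order replaces the mixture by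
  a single intermediate order.\<close>

lemma finite_minimax:
  fixes f :: "real \<Rightarrow> 'p::euclidean_space \<Rightarrow> real"
  assumes "finite F" "F \<noteq> {}" "F \<subseteq> I" "convex I"
    and "\<And>a. a \<in> I \<Longrightarrow> continuous_on L (f a)" "\<And>a. a \<in> I \<Longrightarrow> concave_on L (f a)"
    and "\<And>p. p \<in> L \<Longrightarrow> convex_on I (\<lambda>a. f a p)"
    and "K \<subseteq> L" "compact K" "convex K"
    and "\<And>p. p \<in> K \<Longrightarrow> \<exists>a\<in>F. f a p < c"
  shows "\<exists>a\<in>I. \<forall>p\<in>K. f a p < c"
  using assms(1-3,8-)
proof (induction F arbitrary: K rule: finite_ne_induct)
  case (singleton a)
  then show ?case by auto
next
  case (insert a F)
  have aI: "a \<in> I" and FI: "F \<subseteq> I" using insert.prems by auto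
  have cont: "continuous_on K (f a)" if "a \<in> I" for a
    using assms(5)[OF that] insert.prems(2) continuous_on_subset by blast
  have conc: "concave_on K (f a)" if "a \<in> I" for a
    using assms(6)[OF that] insert.prems(2,4) by (auto simp: concave_on_iff subset_iff)
  define K' where "K' = {p \<in> K. c \<le> f a p}"
  have "compact K'"
  proof -
    have "K' = K \<inter> f a -` {c..}" by (auto simp: K'_def)
    moreover have "closed (K \<inter> f a -` {c..})"
      by (rule continuous_closed_preimage)
         (use cont[OF aI] compact_imp_closed[OF insert.prems(3)] in auto)
    ultimately show ?thesis
      using insert.prems(3) compact_Int_closed[of K K'] by (metis inf.absorb_iff2 inf_le1)
  qed
  moreover have "convex K'"
    using conc[OF aI] insert.prems(4) unfolding K'_def concave_on_iff convex_def
    apply clarsimp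
    subgoal for x y u v
      using convex_bound_le[of "- f a x" "- c" "- f a y" u v] 
      by (smt (verit, best) mult_minus_right)
    done
  moreover have "\<exists>a\<in>F. f a p < c" if "p \<in> K'" for p
    using that insert.prems(5)[of p] by (auto simp: K'_def)
  ultimately obtain b where b: "b \<in> I" "\<And>p. p \<in> K' \<Longrightarrow> f b p < c"
    using insert.IH[of K'] FI insert.prems(2) unfolding K'_def by blast
  show ?case
  proof (cases "K = {}")
    case True
    then show ?thesis using aI by auto
  next
    case False
    have "f a p < c \<or> f b p < c" if "p \<in> K" for p
      using b(2)[of p] that by (force simp: K'_def)
    then obtain u v where uv: "0 \<le> u" "0 \<le> v" "u + v = (1::real)"
      "\<And>p. p \<in> K \<Longrightarrow> u * f a p + v * f b p < c"
      using convex_combination_two_functions[of K "f a" "f b" c]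
        False insert.prems(3,4) cont conc aI b(1) by metis
    have "f (u * a + v * b) p < c" if "p \<in> K" for p
    proof -
      have "convex_on I (\<lambda>a. f a p)" using assms(7) that insert.prems(2) by auto
      then have "f (u *\<^sub>R a + v *\<^sub>R b) p \<le> u * f a p + v * f b p"
        using uv aI b(1) unfolding convex_on_def by blast
      then show ?thesis using uv(4)[OF that] by simp
    qed
    moreover have "u * a + v * b \<in> I"
      using convexD[OF assms(4) aI b(1) uv(1-3)] by simp
    ultimately show ?thesis by blast
  qed
qed

text \<open>By compactness finitely many of the relatively open sets on which
  \<open>f a p < c\<close> cover \<open>K\<close>.\<close>

lemma minimax:
  fixes f :: "real \<Rightarrow> 'p::euclidean_space \<Rightarrow> real"
  assumes I: "I \<noteq> {}" "convex I"
    and K: "compact K" "convex K"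
    and "\<And>a. a \<in> I \<Longrightarrow> continuous_on K (f a)" "\<And>a. a \<in> I \<Longrightarrow> concave_on K (f a)"
    and "\<And>p. p \<in> K \<Longrightarrow> convex_on I (\<lambda>a. f a p)"
    and lt: "\<And>p. p \<in> K \<Longrightarrow> \<exists>a\<in>I. f a p < c"
  shows "\<exists>a\<in>I. \<forall>p\<in>K. f a p < c"
proof -
  define U where "U a = K \<inter> f a -` {..<c}" for a
  have "\<exists>T. open T \<and> U a = K \<inter> T" if "a \<in> I" for a
    using assms(5)[OF that] unfolding U_def continuous_on_open_invariant
    by (metis Int_commute open_lessThan)
  then obtain V where V: "\<And>a. a \<in> I \<Longrightarrow> open (V a) \<and> U a = K \<inter> V a" by metis
  have "K \<subseteq> (\<Union>a\<in>I. V a)" using lt V unfolding U_def by (fastforce)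
  then obtain F where F: "F \<subseteq> I" "finite F" "K \<subseteq> (\<Union>a\<in>F. V a)"
    using compactE_image[OF K(1), of I V] V by metis
  show ?thesis
  proof (cases "F = {}")
    case True
    then show ?thesis using F I by auto
  next
    case False
    have "\<exists>a\<in>F. f a p < c" if "p \<in> K" for p
      using F V that unfolding U_def by blast
    then show ?thesis
      using finite_minimax[of F I K f K c] F False assms by blast
  qed
qed

section \<open>Likelihood weights\<close>

lemma affinity_commute: "affinity a A B = affinity (1 - a) B A"
  by (simp add: affinity_def mult.commute)

lemma derivative_nonpos_if_right_max:
  fixes f :: "real \<Rightarrow> real"
  assumes "(f has_real_derivative D) (at 0)" "\<And>t. 0 < t \<Longrightarrow> t < 1 \<Longrightarrow> f t \<le> f 0"
  shows "D \<le> 0"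
proof (rule ccontr)
  assume "\<not> D \<le> 0"
  then obtain d where d: "0 < d" "\<And>h. 0 < h \<Longrightarrow> h < d \<Longrightarrow> f 0 < f (0 + h)"
    using DERIV_pos_inc_right[OF assms(1)] by auto
  have "f 0 < f (min d 1 / 2)" using d(2)[of "min d 1 / 2"] d(1) by simp
  moreover have "min d 1 / 2 < 1" by linarith
  ultimately show False using assms(2)[of "min d 1 / 2"] d(1) by simp
qed

text \<open>The derivative at the maximiser \<rho>0 in the direction of \<rho> cannot be positive,
  and it equals \<open>a\<close> times the difference of the two sides. Positive densities make
  \<open>powr\<close> differentiable.\<close>

lemma affinity_first_order:
  fixes A :: "(real^'a::finite) set"
  assumes a: "0 < a" "a < 1" and "convex A" "\<rho>0 \<in> A" "\<rho> \<in> A"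
    and pos: "\<And>x. 0 < \<rho>0 $ x" "\<And>x. 0 < \<sigma>0 $ x"
    and max: "\<And>\<rho>. \<rho> \<in> A \<Longrightarrow> affinity a \<rho> \<sigma>0 \<le> affinity a \<rho>0 \<sigma>0"
  shows "(\<Sum>x\<in>UNIV. \<rho> $ x * (\<rho>0 $ x / \<sigma>0 $ x) powr (a - 1)) \<le> affinity a \<rho>0 \<sigma>0"
proof -
  define f where "f t = affinity a (\<rho>0 + t *\<^sub>R (\<rho> - \<rho>0)) \<sigma>0" for t
  define D where "D = (\<Sum>x\<in>UNIV. a * (\<rho>0 $ x) powr (a - 1) * (\<rho> $ x - \<rho>0 $ x) * (\<sigma>0 $ x) powr (1 - a))"
  have "(f has_real_derivative D) (at 0)"
  proof -
    have "((\<lambda>t. (\<rho>0 $ x + t * (\<rho> $ x - \<rho>0 $ x)) powr a) has_real_derivative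
        a * (\<rho>0 $ x) powr (a - 1) * (\<rho> $ x - \<rho>0 $ x)) (at 0)" for x
    proof (rule DERIV_chain2[where f = "\<lambda>z. z powr a"])
      show "((\<lambda>z. z powr a) has_real_derivative a * (\<rho>0 $ x) powr (a - 1))
          (at (\<rho>0 $ x + 0 * (\<rho> $ x - \<rho>0 $ x)))"
        using has_real_derivative_powr[of "\<rho>0 $ x" a] pos(1)[of x] by simp
    qed (auto intro!: derivative_eq_intros)
    then show ?thesis
      unfolding f_def D_def affinity_def by (auto intro!: DERIV_sum DERIV_cmult_right)
  qed
  moreover have "f t \<le> f 0" if "0 < t" "t < 1" for t
  proof -
    have "\<rho>0 + t *\<^sub>R (\<rho> - \<rho>0) = (1 - t) *\<^sub>R \<rho>0 + t *\<^sub>R \<rho>" by (simp add: algebra_simps)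
    then have "\<rho>0 + t *\<^sub>R (\<rho> - \<rho>0) \<in> A"
      using convexD[OF assms(3-5), of "1 - t" t] that by simp
    then show ?thesis using max unfolding f_def by simp
  qed
  ultimately have "D \<le> 0" by (rule derivative_nonpos_if_right_max)
  moreover have "D = a * ((\<Sum>x\<in>UNIV. \<rho> $ x * (\<rho>0 $ x / \<sigma>0 $ x) powr (a - 1)) - affinity a \<rho>0 \<sigma>0)"
  proof -
    have "(\<rho>0 $ x) powr (a - 1) * (\<rho> $ x - \<rho>0 $ x) * (\<sigma>0 $ x) powr (1 - a)
      = \<rho> $ x * (\<rho>0 $ x / \<sigma>0 $ x) powr (a - 1) - (\<rho>0 $ x) powr a * (\<sigma>0 $ x) powr (1 - a)" for x
    proof -
      have "(\<rho>0 $ x / \<sigma>0 $ x) powr (a - 1) = (\<rho>0 $ x) powr (a - 1) * (\<sigma>0 $ x) powr (1 - a)"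
        using pos[of x] by (simp add: powr_divide powr_diff field_simps)
      moreover have "(\<rho>0 $ x) powr a = (\<rho>0 $ x) powr (a - 1) * \<rho>0 $ x"
        using pos[of x] by (simp add: powr_diff)
      ultimately show ?thesis by (simp add: algebra_simps)
    qed
    then show ?thesis
      unfolding D_def affinity_def by (simp add: sum_subtractf[symmetric] sum_distrib_left mult.assoc)
  qed
  ultimately show ?thesis using a by (simp add: mult_le_0_iff)
qed

text \<open>A joint maximiser is a maximiser in each argument. The condition for \<sigma> is that
  for \<rho> with the arguments exchanged and order \<open>1 - a\<close>; this inverts the ratio and
  flips the sign of its exponent, so both conditions speak of the same ratio.\<close>

lemma optimal_pair:
  fixes A B :: "(real^'a::finite) set"
  assumes a: "0 < a" "a < 1"
    and A: "compact A" "convex A" "A \<noteq> {}" "\<And>\<rho> x. \<rho> \<in> A \<Longrightarrow> 0 < \<rho> $ x"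
    and B: "compact B" "convex B" "B \<noteq> {}" "\<And>\<sigma> x. \<sigma> \<in> B \<Longrightarrow> 0 < \<sigma> $ x"
  obtains \<rho>0 \<sigma>0 where "\<rho>0 \<in> A" "\<sigma>0 \<in> B"
    "\<And>\<rho>. \<rho> \<in> A \<Longrightarrow> (\<Sum>x\<in>UNIV. \<rho> $ x * (\<rho>0 $ x / \<sigma>0 $ x) powr (a - 1)) \<le> affinity a \<rho>0 \<sigma>0"
    "\<And>\<sigma>. \<sigma> \<in> B \<Longrightarrow> (\<Sum>x\<in>UNIV. \<sigma> $ x * (\<rho>0 $ x / \<sigma>0 $ x) powr a) \<le> affinity a \<rho>0 \<sigma>0"
proof -
  have "continuous_on (A \<times> B) (\<lambda>p. affinity a (fst p) (snd p))"
    by (intro continuous_on_affinity a continuous_intros) (use A(4) B(4) in \<open>force intro: less_imp_le\<close>)+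
  then obtain p where p: "p \<in> A \<times> B"
    "\<And>q. q \<in> A \<times> B \<Longrightarrow> affinity a (fst q) (snd q) \<le> affinity a (fst p) (snd p)"
    using continuous_attains_sup[of "A \<times> B" "\<lambda>p. affinity a (fst p) (snd p)"] A B compact_Times by blast
  obtain \<rho>0 \<sigma>0 where p_eq: "p = (\<rho>0, \<sigma>0)" by fastforce
  have mem: "\<rho>0 \<in> A" "\<sigma>0 \<in> B" using p(1) p_eq by auto
  show thesis
  proof (rule that[OF mem])
    fix \<rho> assume "\<rho> \<in> A"
    then show "(\<Sum>x\<in>UNIV. \<rho> $ x * (\<rho>0 $ x / \<sigma>0 $ x) powr (a - 1)) \<le> affinity a \<rho>0 \<sigma>0"
      using affinity_first_order[OF a A(2) mem(1), of \<rho> \<sigma>0] p(2) p_eq mem A(4) B(4) by force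
  next
    fix \<sigma> assume "\<sigma> \<in> B"
    have "(\<Sum>x\<in>UNIV. \<sigma> $ x * (\<sigma>0 $ x / \<rho>0 $ x) powr ((1 - a) - 1)) \<le> affinity (1 - a) \<sigma>0 \<rho>0"
    proof (rule affinity_first_order[OF _ _ B(2) mem(2) \<open>\<sigma> \<in> B\<close>])
      show "affinity (1 - a) \<rho> \<rho>0 \<le> affinity (1 - a) \<sigma>0 \<rho>0" if "\<rho> \<in> B" for \<rho>
        using p(2)[of "(\<rho>0, \<rho>)"] that mem p_eq
        by (simp add: affinity_commute[of "1 - a"])
    qed (use a A(4) B(4) mem in auto)
    moreover have "(\<sigma>0 $ x / \<rho>0 $ x) powr ((1 - a) - 1) = (\<rho>0 $ x / \<sigma>0 $ x) powr a" for x
      using A(4)[OF mem(1), of x] B(4)[OF mem(2), of x]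
      by (simp add: powr_divide powr_minus field_simps)
    ultimately show "(\<Sum>x\<in>UNIV. \<sigma> $ x * (\<rho>0 $ x / \<sigma>0 $ x) powr a) \<le> affinity a \<rho>0 \<sigma>0"
      by (simp add: affinity_commute[of a])
  qed
qed

text \<open>Shifting both sets by a small constant vector makes all densities positive, so that the
  first-order conditions at a maximiser make sense.\<close>

lemma exists_weight:
  fixes A B :: "(real^'a::finite) set"
  assumes a: "0 < a" "a < 1"
    and A: "compact A" "convex A" "A \<noteq> {}" "\<And>\<rho> x. \<rho> \<in> A \<Longrightarrow> 0 \<le> \<rho> $ x"
    and B: "compact B" "convex B" "B \<noteq> {}" "\<And>\<sigma> x. \<sigma> \<in> B \<Longrightarrow> 0 \<le> \<sigma> $ x"
    and q: "\<And>\<rho> \<sigma>. \<rho> \<in> A \<Longrightarrow> \<sigma> \<in> B \<Longrightarrow> affinity a \<rho> \<sigma> < q"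
  obtains q' u where "q' < q" "\<And>x. 0 < u x"
    "\<And>\<rho>. \<rho> \<in> A \<Longrightarrow> (\<Sum>x\<in>UNIV. \<rho> $ x * u x powr (a - 1)) \<le> q'"
    "\<And>\<sigma>. \<sigma> \<in> B \<Longrightarrow> (\<Sum>x\<in>UNIV. \<sigma> $ x * u x powr a) \<le> q'"
proof -
  define w :: "real^'a" where "w = (\<chi> x. 1)"
  \<comment> \<open>The size of the shift is a coordinate of \<open>F\<close>, so that uniform
    continuity on the compact \<open>Z\<close> controls the shift for all pairs at once.\<close>
  define F where "F z = affinity a (fst (snd z) + fst z *\<^sub>R w) (snd (snd z) + fst z *\<^sub>R w)"
    for z :: "real \<times> (real^'a) \<times> (real^'a)"
  define Z where "Z = {0..1::real} \<times> A \<times> B"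
  have "compact Z" unfolding Z_def using A B by (intro compact_Times) auto
  have F_cont: "continuous_on Z F"
    unfolding F_def
    by (intro continuous_on_affinity a continuous_intros)
       (use A(4) B(4) in \<open>auto simp: Z_def w_def intro!: add_nonneg_nonneg\<close>)
  have "continuous_on (A \<times> B) (\<lambda>p. F (0, p))"
    by (rule continuous_on_compose2[OF F_cont]) (auto simp: Z_def intro!: continuous_intros)
  then obtain p0 where p0: "p0 \<in> A \<times> B" "\<And>p. p \<in> A \<times> B \<Longrightarrow> F (0, p) \<le> F (0, p0)"
    using continuous_attains_sup[of "A \<times> B" "\<lambda>p. F (0, p)"] A B compact_Times by blast
  have p0_lt: "F (0, p0) < q" using q p0(1) by (auto simp: F_def)
  \<comment> \<open>Half of the gap between the maximum and \<open>q\<close> is spent on the shift;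
    the other half keeps \<open>q' < q\<close>.\<close>
  define \<eta> where "\<eta> = (q - F (0, p0)) / 2"
  have "0 < \<eta>" using p0_lt by (simp add: \<eta>_def)
  moreover have "uniformly_continuous_on Z F"
    using compact_uniformly_continuous F_cont \<open>compact Z\<close> by blast
  ultimately obtain d where d: "0 < d"
    "\<And>z z'. z \<in> Z \<Longrightarrow> z' \<in> Z \<Longrightarrow> dist z' z < d \<Longrightarrow> dist (F z') (F z) < \<eta>"
    unfolding uniformly_continuous_on_def by metis
  define \<epsilon> where "\<epsilon> = min (d / 2) 1"
  have \<epsilon>: "0 < \<epsilon>" "\<epsilon> \<le> 1" "\<epsilon> < d" using d(1) by (auto simp: \<epsilon>_def)
  define q' where "q' = F (0, p0) + \<eta>"
  have F\<epsilon>: "F (\<epsilon>, p) \<le> q'" if "p \<in> A \<times> B" for p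
  proof -
    have "dist (F (\<epsilon>, p)) (F (0, p)) < \<eta>"
      using d(2)[of "(0, p)" "(\<epsilon>, p)"] that \<epsilon> by (auto simp: Z_def dist_Pair_Pair)
    then show ?thesis using p0(2)[OF that] by (auto simp: q'_def dist_real_def)
  qed
  have shift: "compact ((\<lambda>\<rho>. \<rho> + \<epsilon> *\<^sub>R w) ` C) \<and> convex ((\<lambda>\<rho>. \<rho> + \<epsilon> *\<^sub>R w) ` C)"
    if "compact C" "convex C" for C
    using that compact_translation[of C "\<epsilon> *\<^sub>R w"] convex_translation[of C "\<epsilon> *\<^sub>R w"]
    by (simp add: add.commute)
  have shift_pos: "0 < \<rho> $ x"
    if C: "\<And>\<rho> x. \<rho> \<in> C \<Longrightarrow> 0 \<le> \<rho> $ x" and mem: "\<rho> \<in> (\<lambda>\<rho>. \<rho> + \<epsilon> *\<^sub>R w) ` C" for C \<rho> x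
  proof -
    obtain \<rho>' where "\<rho>' \<in> C" "\<rho> = \<rho>' + \<epsilon> *\<^sub>R w" using mem by auto
    then show ?thesis using C[of \<rho>' x] \<epsilon>(1) by (simp add: w_def)
  qed
  obtain \<rho>0 \<sigma>0 where opt: "\<rho>0 \<in> (\<lambda>\<rho>. \<rho> + \<epsilon> *\<^sub>R w) ` A" "\<sigma>0 \<in> (\<lambda>\<rho>. \<rho> + \<epsilon> *\<^sub>R w) ` B"
    "\<And>\<rho>. \<rho> \<in> (\<lambda>\<rho>. \<rho> + \<epsilon> *\<^sub>R w) ` A \<Longrightarrow>
      (\<Sum>x\<in>UNIV. \<rho> $ x * (\<rho>0 $ x / \<sigma>0 $ x) powr (a - 1)) \<le> affinity a \<rho>0 \<sigma>0"
    "\<And>\<sigma>. \<sigma> \<in> (\<lambda>\<rho>. \<rho> + \<epsilon> *\<^sub>R w) ` B \<Longrightarrow>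
      (\<Sum>x\<in>UNIV. \<sigma> $ x * (\<rho>0 $ x / \<sigma>0 $ x) powr a) \<le> affinity a \<rho>0 \<sigma>0"
  proof (rule optimal_pair[OF a, of "(\<lambda>\<rho>. \<rho> + \<epsilon> *\<^sub>R w) ` A" "(\<lambda>\<rho>. \<rho> + \<epsilon> *\<^sub>R w) ` B"])
    show "0 < \<rho> $ x" if "\<rho> \<in> (\<lambda>\<rho>. \<rho> + \<epsilon> *\<^sub>R w) ` A" for \<rho> x
      using shift_pos[OF A(4) that] .
    show "0 < \<rho> $ x" if "\<rho> \<in> (\<lambda>\<rho>. \<rho> + \<epsilon> *\<^sub>R w) ` B" for \<rho> x
      using shift_pos[OF B(4) that] .
  qed (use A B shift in auto)
  have opt_le: "affinity a \<rho>0 \<sigma>0 \<le> q'"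
  proof -
    obtain \<rho>1 \<sigma>1 where "\<rho>1 \<in> A" "\<sigma>1 \<in> B" "\<rho>0 = \<rho>1 + \<epsilon> *\<^sub>R w" "\<sigma>0 = \<sigma>1 + \<epsilon> *\<^sub>R w"
      using opt(1,2) by blast
    then show ?thesis using F\<epsilon>[of "(\<rho>1, \<sigma>1)"] by (simp add: F_def)
  qed
  have pos: "0 < \<rho>0 $ x / \<sigma>0 $ x" for x
    using shift_pos[OF A(4) opt(1)] shift_pos[OF B(4) opt(2)] by simp
  \<comment> \<open>The weights are nonnegative, so undoing the shift can only lower the
    means.\<close>
  have shift_le: "(\<Sum>x\<in>UNIV. \<rho> $ x * v x) \<le> (\<Sum>x\<in>UNIV. (\<rho> + \<epsilon> *\<^sub>R w) $ x * v x)"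
    if "\<And>x. 0 \<le> v x" for \<rho> and v :: "'a \<Rightarrow> real"
    by (rule sum_mono) (use that \<epsilon> in \<open>auto simp: w_def intro!: mult_right_mono\<close>)
  show thesis
  proof (rule that[of q' "\<lambda>x. \<rho>0 $ x / \<sigma>0 $ x"])
    show "q' < q" using p0_lt by (simp add: q'_def \<eta>_def field_simps)
    show "(\<Sum>x\<in>UNIV. \<rho> $ x * (\<rho>0 $ x / \<sigma>0 $ x) powr (a - 1)) \<le> q'" if "\<rho> \<in> A" for \<rho>
      using shift_le[of "\<lambda>x. (\<rho>0 $ x / \<sigma>0 $ x) powr (a - 1)" \<rho>] opt(3)[of "\<rho> + \<epsilon> *\<^sub>R w"] opt_le that
      by (meson image_eqI order_trans powr_ge_zero)
    show "(\<Sum>x\<in>UNIV. \<sigma> $ x * (\<rho>0 $ x / \<sigma>0 $ x) powr a) \<le> q'" if "\<sigma> \<in> B" for \<sigma>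
      using shift_le[of "\<lambda>x. (\<rho>0 $ x / \<sigma>0 $ x) powr a" \<sigma>] opt(4)[of "\<sigma> + \<epsilon> *\<^sub>R w"] opt_le that
      by (meson image_eqI order_trans powr_ge_zero)
  qed (rule pos)
qed

lemma uniform_weight:
  fixes A B :: "(real^'a::finite) set"
  assumes A: "compact A" "convex A" "A \<noteq> {}" "\<And>\<rho> x. \<rho> \<in> A \<Longrightarrow> 0 \<le> \<rho> $ x"
    and B: "compact B" "convex B" "B \<noteq> {}" "\<And>\<sigma> x. \<sigma> \<in> B \<Longrightarrow> 0 \<le> \<sigma> $ x"
    and lt: "\<And>\<rho> \<sigma>. \<rho> \<in> A \<Longrightarrow> \<sigma> \<in> B \<Longrightarrow> \<exists>a\<in>{0<..<1}. affinity a \<rho> \<sigma> < 1"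
  obtains a q u where "0 < a" "a < 1" "q < 1" "\<And>x. 0 < u x"
    "\<And>\<rho>. \<rho> \<in> A \<Longrightarrow> (\<Sum>x\<in>UNIV. \<rho> $ x * u x powr (a - 1)) \<le> q"
    "\<And>\<sigma>. \<sigma> \<in> B \<Longrightarrow> (\<Sum>x\<in>UNIV. \<sigma> $ x * u x powr a) \<le> q"
proof -
  have "\<exists>a\<in>{0<..<1}. \<forall>p\<in>A \<times> B. affinity a (fst p) (snd p) < 1"
  proof (rule minimax)
    show "convex (A \<times> B)" "compact (A \<times> B)" using A B by (auto intro: convex_Times compact_Times)
    show "continuous_on (A \<times> B) (\<lambda>p. affinity a (fst p) (snd p))" if "a \<in> {0<..<1}" for a
      by (intro continuous_on_affinity continuous_intros) (use A(4) B(4) that in auto)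
    show "concave_on (A \<times> B) (\<lambda>p. affinity a (fst p) (snd p))" if "a \<in> {0<..<1}" for a
      using that A(4) B(4) \<open>convex (A \<times> B)\<close> unfolding concave_on_iff
      by (auto intro!: affinity_concave)
    show "convex_on {0<..<1} (\<lambda>a. affinity a (fst p) (snd p))" if "p \<in> A \<times> B" for p
      using that A(4) B(4) affinity_convex_order[of _ _ _ _ "fst p" "snd p"]
      unfolding convex_on_def by (auto simp: convex_real_interval)
  qed (use lt in auto)
  then obtain a where a: "0 < a" "a < 1" "\<And>\<rho> \<sigma>. \<rho> \<in> A \<Longrightarrow> \<sigma> \<in> B \<Longrightarrow> affinity a \<rho> \<sigma> < 1" by auto
  show thesis
    by (rule exists_weight[OF a(1,2) A B a(3)]) (assumption | rule that[OF a(1,2)])+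
qed

section \<open>Adversarial hypotheses and tests\<close>

lemma finite_seqs [simp]: "finite (seqs n :: 'a::finite list set)"
  using finite_lists_length_eq[of "UNIV :: 'a set" n] by (simp add: seqs_def)

lemma seqs_0 [simp]: "seqs 0 = {[]}"
  by (auto simp: seqs_def)

lemma sum_seqs_Suc:
  fixes f :: "'a::finite list \<Rightarrow> real"
  shows "(\<Sum>xs\<in>seqs (Suc n). f xs) = (\<Sum>xs\<in>seqs n. \<Sum>x\<in>UNIV. f (xs @ [x]))"
proof -
  have "bij_betw (\<lambda>(xs, x). xs @ [x]) (seqs n \<times> UNIV) (seqs (Suc n) :: 'a list set)"
  proof (rule bij_betwI')
    fix ys :: "'a list" assume "ys \<in> seqs (Suc n)"
    then show "\<exists>p\<in>seqs n \<times> UNIV. ys = (case p of (xs, x) \<Rightarrow> xs @ [x])"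
      by (cases ys rule: rev_cases) (auto simp: seqs_def)
  qed (auto simp: seqs_def)
  then show ?thesis
    by (simp add: sum.reindex_bij_betw[symmetric] sum.cartesian_product case_prod_beta)
qed

lemma prefix_prob_split:
  fixes xs :: "'a::finite list"
  assumes "length xs < n"
  shows "prefix_prob n \<omega> xs = (\<Sum>x\<in>UNIV. prefix_prob n \<omega> (xs @ [x]))"
proof -
  have "{ys. ys \<in> seqs n \<and> take (length xs) ys = xs} =
    (\<Union>x. {ys. ys \<in> seqs n \<and> take (length (xs @ [x])) ys = xs @ [x]})"
    using assms by (auto simp: seqs_def take_Suc_conv_app_nth)
  moreover have "(\<Sum>ys\<in>(\<Union>x. {ys. ys \<in> seqs n \<and> take (length (xs @ [x])) ys = xs @ [x]}). \<omega> ys) =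
    (\<Sum>x\<in>UNIV. \<Sum>ys | ys \<in> seqs n \<and> take (length (xs @ [x])) ys = xs @ [x]. \<omega> ys)"
    by (rule sum.UNION_disjoint) (auto intro: finite_subset[OF _ finite_seqs[of n]])
  ultimately show ?thesis unfolding prefix_prob_def by simp
qed

lemma prefix_prob_full:
  assumes "length xs = n"
  shows "prefix_prob n \<omega> xs = \<omega> xs"
proof -
  have "{ys. ys \<in> seqs n \<and> take (length xs) ys = xs} = {xs}"
    using assms by (auto simp: seqs_def)
  then show ?thesis by (simp add: prefix_prob_def)
qed

lemma prefix_prob_Nil: "prefix_prob n \<omega> [] = (\<Sum>xs\<in>seqs n. \<omega> xs)"
  by (simp add: prefix_prob_def)

lemma prefix_prob_nonneg: "\<omega> \<in> states_n n \<Longrightarrow> 0 \<le> prefix_prob n \<omega> xs"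
  unfolding prefix_prob_def states_n_def by (auto intro!: sum_nonneg)

lemma prefix_prob_append_le:
  fixes xs :: "'a::finite list"
  assumes "\<omega> \<in> states_n n" "length xs < n"
  shows "prefix_prob n \<omega> (xs @ [x]) \<le> prefix_prob n \<omega> xs"
  unfolding prefix_prob_split[OF assms(2)]
  by (rule member_le_sum) (auto intro: prefix_prob_nonneg[OF assms(1)])

text \<open>Every further coordinate contributes at most a factor \<open>m\<close>, since its conditional
  distribution lies in \<open>A\<close>.\<close>

lemma adv_expect_prod_list_le:
  fixes f :: "'a::finite \<Rightarrow> real"
  assumes \<omega>: "\<omega> \<in> adv A n" and "0 < n" "\<And>x. 0 \<le> f x" "0 \<le> m"
    and m: "\<And>\<rho>. \<rho> \<in> A \<Longrightarrow> (\<Sum>x\<in>UNIV. \<rho> $ x * f x) \<le> m"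
  shows "expect n \<omega> (\<lambda>xs. prod_list (map f xs)) \<le> m ^ n"
proof -
  have st: "\<omega> \<in> states_n n" using \<omega> by (simp add: adv_def)
  define P where "P k = (\<Sum>xs\<in>seqs k. prefix_prob n \<omega> xs * prod_list (map f xs))" for k
  have step: "(\<Sum>x\<in>UNIV. prefix_prob n \<omega> (xs @ [x]) * f x) \<le> prefix_prob n \<omega> xs * m"
    if "xs \<in> seqs k" "k < n" for xs k
  \<comment> \<open>\<open>adv\<close> imposes nothing after a prefix of probability 0, but then all
    extensions have probability 0 as well.\<close>
  proof (cases "prefix_prob n \<omega> xs = 0")
    case True
    then have "prefix_prob n \<omega> (xs @ [x]) = 0" for x
      using prefix_prob_append_le[OF st, of xs x] prefix_prob_nonneg[OF st, of "xs @ [x]"] that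
      by (simp add: seqs_def)
    then show ?thesis using True by simp
  next
    case False
    then have pos: "0 < prefix_prob n \<omega> xs"
      using prefix_prob_nonneg[OF st, of xs] by simp
    have "cond_dist n \<omega> xs \<in> A"
    \<comment> \<open>For the empty prefix, of probability 1, the condition is the one on the first
      marginal.\<close>
    proof (cases "k = 0")
      case True
      then have "cond_dist n \<omega> xs = (\<chi> x. prefix_prob n \<omega> [x])"
        using that st by (simp add: cond_dist_def prefix_prob_Nil states_n_def)
      then show ?thesis using \<omega> by (simp add: adv_def)
    next
      case False
      then show ?thesis using \<omega> that pos by (auto simp: adv_def)
    qed
    from m[OF this] have "(\<Sum>x\<in>UNIV. prefix_prob n \<omega> (xs @ [x]) / prefix_prob n \<omega> xs * f x) \<le> m"
      by (simp add: cond_dist_def)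
    then have "(\<Sum>x\<in>UNIV. prefix_prob n \<omega> (xs @ [x]) * f x) / prefix_prob n \<omega> xs \<le> m"
      by (simp add: sum_divide_distrib)
    then show ?thesis using pos by (simp add: pos_divide_le_eq mult.commute)
  qed
  have "P k \<le> m ^ k" if "k \<le> n" for k
    using that
  proof (induction k)
    case 0
    then show ?case using st by (simp add: P_def prefix_prob_Nil states_n_def)
  next
    case (Suc k)
    have nonneg: "0 \<le> prod_list (map f xs)" for xs
      using assms(3) by (induction xs) auto
    have "P (Suc k) = (\<Sum>xs\<in>seqs k. prod_list (map f xs) * (\<Sum>x\<in>UNIV. prefix_prob n \<omega> (xs @ [x]) * f x))"
      by (simp add: P_def sum_seqs_Suc sum_distrib_left mult_ac)
    also have "\<dots> \<le> (\<Sum>xs\<in>seqs k. prod_list (map f xs) * (prefix_prob n \<omega> xs * m))"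
      using Suc.prems by (intro sum_mono mult_left_mono step[of _ k] nonneg) auto
    also have "\<dots> = P k * m"
      by (simp add: P_def sum_distrib_left mult_ac)
    also have "\<dots> \<le> m ^ Suc k"
      using Suc assms(4) by (simp add: mult.commute mult_left_mono)
    finally show ?case .
  qed
  from this[of n] show ?thesis
    by (simp add: P_def expect_def prefix_prob_full seqs_def)
qed

text \<open>Downward induction from \<open>k = n\<close>, where the prefix is the whole list; each
  step sums out one factor of mass 1. The case \<open>k = 0\<close> is the normalisation of the
  product density.\<close>

lemma prefix_prob_prod_state:
  fixes \<rho> :: "nat \<Rightarrow> real^'a::finite"
  assumes "\<And>i. i < n \<Longrightarrow> \<rho> i \<in> states" "k \<le> n"
  shows "\<forall>xs\<in>seqs k. prefix_prob n (prod_state n \<rho>) xs = (\<Prod>i<k. \<rho> i $ (xs ! i))"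
  using assms(2)
proof (induction rule: inc_induct)
  case base
  then show ?case by (simp add: prefix_prob_full seqs_def prod_state_def)
next
  case (step k)
  show ?case
  proof
    fix xs :: "'a list" assume xs: "xs \<in> seqs k"
    then have "prefix_prob n (prod_state n \<rho>) xs
      = (\<Sum>x\<in>UNIV. \<Prod>i<Suc k. \<rho> i $ ((xs @ [x]) ! i))"
      using step by (subst prefix_prob_split) (auto simp: seqs_def simp del: prod.lessThan_Suc)
    also have "\<dots> = (\<Sum>x\<in>UNIV. (\<Prod>i<k. \<rho> i $ (xs ! i)) * \<rho> k $ x)"
      using xs by (intro sum.cong refl) (auto simp: seqs_def nth_append)
    also have "\<dots> = (\<Prod>i<k. \<rho> i $ (xs ! i)) * (\<Sum>x\<in>UNIV. \<rho> k $ x)"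
      by (simp add: sum_distrib_left)
    also have "(\<Sum>x\<in>UNIV. \<rho> k $ x) = 1" using assms(1)[of k] step by (simp add: states_def)
    finally show "prefix_prob n (prod_state n \<rho>) xs = (\<Prod>i<k. \<rho> i $ (xs ! i))" by simp
  qed
qed

lemma prod_state_states_n:
  assumes "\<And>i. i < n \<Longrightarrow> \<rho> i \<in> states"
  shows "prod_state n \<rho> \<in> states_n n"
  using prefix_prob_prod_state[of n \<rho> 0] assms
  by (auto simp: states_n_def prefix_prob_Nil prod_state_def states_def intro!: prod_nonneg)

lemma av_subset_adv:
  assumes "A \<subseteq> states" "0 < n"
  shows "av A n \<subseteq> adv A n"
proof
  fix \<omega> assume "\<omega> \<in> av A n"
  then obtain \<rho> where \<rho>: "\<omega> = prod_state n \<rho>" "\<And>i. i < n \<Longrightarrow> \<rho> i \<in> A" by (auto simp: av_def)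
  then have st: "\<rho> i \<in> states" if "i < n" for i using assms that by auto
  have pp: "prefix_prob n \<omega> xs = (\<Prod>i<length xs. \<rho> i $ (xs ! i))" if "length xs \<le> n" for xs
    using prefix_prob_prod_state[OF st that] \<rho>(1) by (simp add: seqs_def)
  have "(\<chi> x. prefix_prob n \<omega> [x]) = \<rho> 0"
    using assms(2) by (simp add: vec_eq_iff pp)
  moreover have "cond_dist n \<omega> xs = \<rho> k"
    if "k \<in> {1..<n}" "xs \<in> seqs k" "0 < prefix_prob n \<omega> xs" for k xs
  proof -
    have "prefix_prob n \<omega> (xs @ [x]) = prefix_prob n \<omega> xs * \<rho> k $ x" for x
      using that by (simp add: pp seqs_def nth_append)
    then show ?thesis using that(3) by (simp add: cond_dist_def vec_eq_iff)
  qed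
  ultimately show "\<omega> \<in> adv A n"
    using prod_state_states_n[OF st] \<rho> assms(2) by (auto simp: adv_def)
qed

lemma iid_subset_av: "iid A n \<subseteq> av A n"
  by (auto simp: iid_def av_def)

lemma av_mono: "A \<subseteq> B \<Longrightarrow> av A n \<subseteq> av B n"
  unfolding av_def by blast

lemma adv_mono: "A \<subseteq> B \<Longrightarrow> adv A n \<subseteq> adv B n"
  unfolding adv_def by blast

lemma adv_subset_states_n: "adv A n \<subseteq> states_n n"
  unfolding adv_def by blast

lemma adv_expect_mono:
  assumes "\<omega> \<in> adv A n" "\<And>xs. f xs \<le> g xs"
  shows "expect n \<omega> f \<le> expect n \<omega> g"
  using assms adv_subset_states_n[of A n] unfolding expect_def states_n_def
  by (intro sum_mono mult_left_mono) auto

lemma iid_nonempty: "A \<noteq> {} \<Longrightarrow> iid A n \<noteq> {}"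
  unfolding iid_def by blast

lemma prod_state_iid:
  "xs \<in> seqs n \<Longrightarrow> prod_state n (\<lambda>_. \<rho>) xs = prod_list (map (($) \<rho>) xs)"
  by (simp add: prod_state_def seqs_def prod.list_conv_set_nth atLeast0LessThan)

section \<open>Error probabilities and exponential rates\<close>

lemma err1_eq: "err1 R T = err2 R (\<lambda>n xs. 1 - T n xs)"
  by (simp add: err1_def err2_def fun_eq_iff)

lemma test_seq_complement: "test_seq T \<Longrightarrow> test_seq (\<lambda>n xs. 1 - T n xs)"
  by (auto simp: test_seq_def)

lemma expect_test_bounds:
  fixes \<omega> :: "'a::finite list \<Rightarrow> real"
  assumes "test_seq T" "\<omega> \<in> states_n n"
  shows "0 \<le> expect n \<omega> (T n)" "expect n \<omega> (T n) \<le> 1"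
proof -
  have \<omega>: "0 \<le> \<omega> xs" if "xs \<in> seqs n" for xs using assms that by (auto simp: states_n_def)
  have T: "0 \<le> T n xs" "T n xs \<le> 1" if "xs \<in> seqs n" for xs
    using assms that by (auto simp: test_seq_def)
  show "0 \<le> expect n \<omega> (T n)"
    unfolding expect_def using \<omega> T by (intro sum_nonneg) auto
  have "expect n \<omega> (T n) \<le> (\<Sum>xs\<in>seqs n. \<omega> xs)"
    unfolding expect_def using \<omega> T by (intro sum_mono mult_left_le) auto
  then show "expect n \<omega> (T n) \<le> 1" using assms(2) by (simp add: states_n_def)
qed

text \<open>The supremum is one of real numbers and needs an upper bound; test values are at most 1,
  so 1 is one.\<close>

lemma expect_le_err2:
  fixes \<omega> :: "'a::finite list \<Rightarrow> real"
  assumes "test_seq T" "R n \<subseteq> states_n n" "\<omega> \<in> R n"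
  shows "expect n \<omega> (T n) \<le> err2 R T n"
  unfolding err2_def
  by (rule cSUP_upper) (use assms expect_test_bounds(2) in \<open>fastforce intro!: bdd_aboveI2\<close>)+

lemma err2_le:
  assumes "R n \<noteq> {}" "\<And>\<omega>. \<omega> \<in> R n \<Longrightarrow> expect n \<omega> (T n) \<le> b"
  shows "err2 R T n \<le> b"
  unfolding err2_def using assms by (rule cSUP_least)

lemma err2_nonneg:
  fixes R :: "'a::finite hyp"
  assumes "test_seq T" "R n \<subseteq> states_n n" "R n \<noteq> {}"
  shows "0 \<le> err2 R T n"
proof -
  obtain \<omega> where "\<omega> \<in> R n" using assms by auto
  then show ?thesis
    using expect_test_bounds(1)[OF assms(1)] expect_le_err2[of T R n \<omega>] assms by (meson order_trans subsetD)
qed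

lemma err2_mono:
  fixes R :: "'a::finite hyp"
  assumes "test_seq T" "R' n \<subseteq> R n" "R n \<subseteq> states_n n" "R' n \<noteq> {}"
  shows "err2 R' T n \<le> err2 R T n"
  by (rule err2_le) (use assms expect_le_err2 in blast)+

lemma elog_mono: "0 \<le> s \<Longrightarrow> s \<le> t \<Longrightarrow> elog s \<le> elog t"
  by (auto simp: elog_def)

lemma elog_le_iff: "0 \<le> t \<Longrightarrow> elog t \<le> ereal c \<longleftrightarrow> t \<le> exp c"
  by (cases "t = 0") (auto simp: elog_def ln_ge_iff simp flip: exp_le_cancel_iff[of "ln t"])

text \<open>A liminf ignores \<open>n = 0\<close>, where \<open>1 / real n\<close> is 0 by
  convention and \<open>adv\<close> gives an empty set. Nonnegativity keeps \<open>elog\<close>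
  within its meaningful range.\<close>

lemma rate_ge:
  assumes "\<And>n. 0 < n \<Longrightarrow> 0 \<le> a n" "\<And>n. 0 < n \<Longrightarrow> a n \<le> exp (- c) ^ n"
  shows "ereal c \<le> rate a"
  unfolding rate_def
proof (rule Liminf_bounded)
  show "\<forall>\<^sub>F n in sequentially. ereal c \<le> ereal (- (1 / real n)) * elog (a n)"
    using eventually_gt_at_top[of 0]
  proof eventually_elim
    case (elim n)
    have "a n \<le> exp (- (c * real n))"
      using assms(2)[OF elim] by (simp add: exp_of_nat_mult[symmetric] mult.commute)
    then have "elog (a n) \<le> ereal (- (c * real n))"
      using assms(1)[OF elim] by (simp add: elog_le_iff)
    then show ?case using elim by (cases "elog (a n)") (auto simp: field_simps)
  qed
qed

lemma rate_mono:
  assumes "\<And>n. 0 < n \<Longrightarrow> 0 \<le> b n" "\<And>n. 0 < n \<Longrightarrow> b n \<le> a n"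
  shows "rate a \<le> rate b"
  unfolding rate_def
proof (rule Liminf_mono)
  show "\<forall>\<^sub>F n in sequentially.
      ereal (- (1 / real n)) * elog (a n) \<le> ereal (- (1 / real n)) * elog (b n)"
    using eventually_gt_at_top[of 0]
  proof eventually_elim
    case (elim n)
    have "elog (b n) \<le> elog (a n)" using assms[OF elim] by (rule elog_mono)
    then show ?case
      using elim by (cases "elog (a n)"; cases "elog (b n)") (auto simp: divide_right_mono)
  qed
qed

lemma rate_gt_imp_eventually_le:
  assumes "ereal c < rate a" "\<And>n. 0 < n \<Longrightarrow> 0 \<le> a n"
  shows "\<forall>\<^sub>F n in sequentially. a n \<le> exp (- c) ^ n"
proof -
  have "\<forall>\<^sub>F n in sequentially. ereal c < ereal (- (1 / real n)) * elog (a n)"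
    using less_LiminfD[of "ereal c"] assms(1) unfolding rate_def by blast
  then show ?thesis
    using eventually_gt_at_top[of 0]
  proof eventually_elim
    case (elim n)
    then have "elog (a n) \<le> ereal (- (c * real n))"
      by (cases "elog (a n)") (auto simp: field_simps)
    then show ?case
      using assms(2) elim by (simp add: elog_le_iff exp_of_nat_mult[symmetric] mult.commute)
  qed
qed

text \<open>The weight \<open>u\<close> serves as a likelihood ratio for the scaled densities.
  Removing the scaling turns the bound \<open>q\<close> on its means into
  \<open>exp (- c) * q\<close> and \<open>exp (- r) * q\<close>, and these bounds multiply along the
  samples even against an adversary.\<close>

lemma adv_tests:
  fixes A B :: "(real^'a::finite) set"
  assumes A: "compact A" "convex A" "A \<noteq> {}" "A \<subseteq> states"
    and B: "compact B" "convex B" "B \<noteq> {}" "B \<subseteq> states"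
    and lt: "\<And>\<rho> \<sigma>. \<rho> \<in> A \<Longrightarrow> \<sigma> \<in> B \<Longrightarrow>
      \<exists>a\<in>{0<..<1}. affinity a (exp c *\<^sub>R \<rho>) (exp r *\<^sub>R \<sigma>) < 1"
  obtains T q where "test_seq T" "0 \<le> q" "q < 1"
    "\<And>n. 0 < n \<Longrightarrow> err1 (adv A) T n \<le> (exp (- c) * q) ^ n"
    "\<And>n. 0 < n \<Longrightarrow> err2 (adv B) T n \<le> (exp (- r) * q) ^ n"
proof -
  have nn: "0 \<le> \<rho> $ x" if "\<rho> \<in> A \<union> B" for \<rho> x
    using that A(4) B(4) by (auto simp: states_def)
  have scaled: "compact ((*\<^sub>R) (exp s) ` C)" "convex ((*\<^sub>R) (exp s) ` C)" if "compact C" "convex C"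
    for s and C :: "(real^'a) set"
    using that by (auto intro: compact_scaling convex_scaling)
  obtain a q u where a: "0 < a" "a < 1" "q < 1" "\<And>x. 0 < u x"
    and uA: "\<And>\<rho>. \<rho> \<in> (*\<^sub>R) (exp c) ` A \<Longrightarrow> (\<Sum>x\<in>UNIV. \<rho> $ x * u x powr (a - 1)) \<le> q"
    and uB: "\<And>\<sigma>. \<sigma> \<in> (*\<^sub>R) (exp r) ` B \<Longrightarrow> (\<Sum>x\<in>UNIV. \<sigma> $ x * u x powr a) \<le> q"
    by (rule uniform_weight[OF scaled[OF A(1,2), of c] _ _ scaled[OF B(1,2), of r]])
       (use A(3) B(3) nn lt in \<open>auto simp: image_iff\<close>)
  have mA: "(\<Sum>x\<in>UNIV. \<rho> $ x * u x powr (a - 1)) \<le> exp (- c) * q" if "\<rho> \<in> A" for \<rho>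
    using uA[of "exp c *\<^sub>R \<rho>"] that
    by (simp add: exp_minus field_simps sum_distrib_left[symmetric] sum_distrib_right[symmetric])
  have mB: "(\<Sum>x\<in>UNIV. \<sigma> $ x * u x powr a) \<le> exp (- r) * q" if "\<sigma> \<in> B" for \<sigma>
    using uB[of "exp r *\<^sub>R \<sigma>"] that
    by (simp add: exp_minus field_simps sum_distrib_left[symmetric] sum_distrib_right[symmetric])
  have "0 \<le> q"
  proof -
    obtain \<rho> where \<rho>: "\<rho> \<in> A" using A(3) by auto
    have "0 \<le> (\<Sum>x\<in>UNIV. \<rho> $ x * u x powr (a - 1))" using nn \<rho> by (intro sum_nonneg) auto
    then show ?thesis using mA[OF \<rho>] by (meson exp_gt_zero order_trans zero_le_mult_iff not_le)
  qed
  define T where "T n xs = (if 1 \<le> prod_list (map u xs) then 1 else 0 :: real)" for n :: nat and xs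
  have pos: "0 < prod_list (map u xs)" for xs using a(4) by (induction xs) auto
  have powr_prod: "prod_list (map u xs) powr b = prod_list (map (\<lambda>x. u x powr b) xs)" for xs b
    using a(4) pos by (induction xs) (auto simp: powr_mult less_imp_le)
  have adv_ne: "adv C n \<noteq> {}" if "C \<noteq> {}" "C \<subseteq> states" "0 < n" for C :: "(real^'a) set" and n
    using iid_nonempty[OF that(1), of n] iid_subset_av[of C n] av_subset_adv[OF that(2,3)] by blast
  \<comment> \<open>Markov bounds with threshold 1: where the test rejects, the product of the
    weights is below 1 and its negative power \<open>a - 1\<close> is at least 1; where it accepts,
    the power \<open>a\<close> is at least 1.\<close>
  have T1: "1 - T n xs \<le> prod_list (map (\<lambda>x. u x powr (a - 1)) xs)" for n xs
    using pos[of xs] a(1,2) powr_prod[of xs "a - 1", symmetric]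
      powr_mono2'[of "a - 1" "prod_list (map u xs)" 1] by (auto simp: T_def)
  have T2: "T n xs \<le> prod_list (map (\<lambda>x. u x powr a) xs)" for n xs
    using pos[of xs] a(1,2) powr_prod[of xs a, symmetric] by (auto simp: T_def ge_one_powr_ge_zero)
  show thesis
  proof (rule that[of T q])
    show "test_seq T" by (auto simp: test_seq_def T_def)
    fix n :: nat assume n: "0 < n"
    show "err1 (adv A) T n \<le> (exp (- c) * q) ^ n"
      unfolding err1_eq
      by (rule err2_le[where R = "adv A" and n = n, OF adv_ne[OF A(3,4) n]])
         (rule order_trans[OF adv_expect_mono[OF _ T1] adv_expect_prod_list_le],
           use mA n \<open>0 \<le> q\<close> in auto)
    show "err2 (adv B) T n \<le> (exp (- r) * q) ^ n"
      by (rule err2_le[where R = "adv B" and n = n, OF adv_ne[OF B(3,4) n]])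
         (rule order_trans[OF adv_expect_mono[OF _ T2] adv_expect_prod_list_le],
           use mB n \<open>0 \<le> q\<close> in auto)
  qed fact+
qed

section \<open>Converse for a pair of densities\<close>

text \<open>The finite branch of \<open>relative_entropy\<close>, kept real for calculations under
  inclusion of supports.\<close>

definition kl :: "real^'a::finite \<Rightarrow> real^'a \<Rightarrow> real" where
  "kl \<rho> \<sigma> = (\<Sum>x\<in>UNIV. \<rho> $ x * ln (\<rho> $ x / \<sigma> $ x))"

lemma states_nonneg: "\<rho> \<in> states \<Longrightarrow> 0 \<le> \<rho> $ x"
  by (simp add: states_def)

lemma states_sum: "\<rho> \<in> states \<Longrightarrow> (\<Sum>x\<in>UNIV. \<rho> $ x) = 1"
  by (simp add: states_def)

text \<open>As a function of \<open>s\<close> the mean is 1 at 0, and its derivative there is the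
  mean of \<open>ln (u x)\<close>, which is negative.\<close>

lemma exists_powr_mean_less_1:
  fixes p u :: "'a::finite \<Rightarrow> real"
  assumes "(\<Sum>x\<in>UNIV. p x) = 1" "\<And>x. p x \<noteq> 0 \<Longrightarrow> 0 < u x" "(\<Sum>x\<in>UNIV. p x * ln (u x)) < 0"
  shows "\<exists>s\<in>{0<..<1}. (\<Sum>x\<in>UNIV. p x * u x powr s) < 1"
proof -
  \<comment> \<open>With \<open>exp\<close> in place of \<open>powr\<close> the function is
    differentiable whatever \<open>u x\<close> is at letters with \<open>p x = 0\<close>.\<close>
  define F where "F s = (\<Sum>x\<in>UNIV. p x * exp (s * ln (u x)))" for s
  have "(F has_real_derivative (\<Sum>x\<in>UNIV. p x * ln (u x))) (at 0)"
    unfolding F_def by (auto intro!: derivative_eq_intros sum.cong)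
  then obtain d where d: "0 < d" "\<And>h. 0 < h \<Longrightarrow> h < d \<Longrightarrow> F (0 + h) < F 0"
    using DERIV_neg_dec_right[of F _ 0] assms(3) by auto
  define s where "s = min d 1 / 2"
  have s: "0 < s" "s < d" "s < 1" using d(1) by (auto simp: s_def min_def)
  have "F 0 = 1" using assms(1) by (simp add: F_def)
  moreover have "(\<Sum>x\<in>UNIV. p x * u x powr s) = F s"
  proof -
    have "p x * u x powr s = p x * exp (s * ln (u x))" for x
      using assms(2)[of x] by (cases "p x = 0") (auto simp: powr_def)
    then show ?thesis unfolding F_def by (rule sum.cong[OF refl])
  qed
  ultimately have "(\<Sum>x\<in>UNIV. p x * u x powr s) < 1" using d(2)[of s] s by simp
  then show ?thesis using s by (intro bexI[of _ s]) auto
qed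

lemma sum_seqs_prod_list:
  fixes f :: "'a::finite \<Rightarrow> real"
  shows "(\<Sum>xs\<in>seqs n. prod_list (map f xs)) = (\<Sum>x\<in>UNIV. f x) ^ n"
  by (induction n) (simp_all add: sum_seqs_Suc sum_distrib_left[symmetric] sum_distrib_right[symmetric] mult.commute)

lemma prod_list_map_nonneg:
  fixes f :: "'a \<Rightarrow> real"
  shows "(\<And>x. 0 \<le> f x) \<Longrightarrow> 0 \<le> prod_list (map f xs)"
  by (induction xs) auto

lemma prod_list_map_mult:
  fixes f g :: "'a \<Rightarrow> real"
  shows "prod_list (map (\<lambda>x. f x * g x) xs) = prod_list (map f xs) * prod_list (map g xs)"
  by (induction xs) auto

text \<open>The complement of the event \<open>\<tau>\<^sup>n \<le> exp (n d) \<sigma>\<^sup>n\<close> has exponentially small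
  \<open>\<tau>\<^sup>n\<close>-probability by a Chernoff bound.\<close>

lemma change_of_measure:
  fixes \<tau> \<sigma> :: "real^'a::finite"
  assumes \<tau>: "\<tau> \<in> states" and \<sigma>: "\<sigma> \<in> states" and supp: "supp \<tau> \<subseteq> supp \<sigma>" and d: "kl \<tau> \<sigma> < d"
  obtains q where "0 \<le> q" "q < 1"
    "\<And>T n. test_seq T \<Longrightarrow> expect n (prod_state n (\<lambda>_. \<tau>)) (T n)
       \<le> exp d ^ n * expect n (prod_state n (\<lambda>_. \<sigma>)) (T n) + q ^ n"
proof -
  \<comment> \<open>The ratio of the densities, discounted by \<open>d\<close>: the mean of its
    logarithm under \<tau> is \<open>kl \<tau> \<sigma> - d < 0\<close>.\<close>
  define v where "v x = \<tau> $ x / \<sigma> $ x * exp (- d)" for x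
  have pos: "0 < \<tau> $ x \<and> 0 < \<sigma> $ x" if "\<tau> $ x \<noteq> 0" for x
    using that supp states_nonneg[OF \<tau>, of x] states_nonneg[OF \<sigma>, of x] unfolding supp_def by force
  have "(\<Sum>x\<in>UNIV. \<tau> $ x * ln (v x)) = (\<Sum>x\<in>UNIV. \<tau> $ x * ln (\<tau> $ x / \<sigma> $ x) - \<tau> $ x * d)"
  proof (rule sum.cong[OF refl])
    fix x
    show "\<tau> $ x * ln (v x) = \<tau> $ x * ln (\<tau> $ x / \<sigma> $ x) - \<tau> $ x * d"
    proof (cases "\<tau> $ x = 0")
      case False
      then have "ln (v x) = ln (\<tau> $ x / \<sigma> $ x) - d"
        using pos[OF False] unfolding v_def by (subst ln_mult) auto
      then show ?thesis by (simp add: right_diff_distrib)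
    qed simp
  qed
  also have "\<dots> = kl \<tau> \<sigma> - d"
    by (simp add: kl_def sum_subtractf sum_distrib_right[symmetric] states_sum[OF \<tau>])
  finally have "(\<Sum>x\<in>UNIV. \<tau> $ x * ln (v x)) < 0" using d by simp
  then obtain s where s: "0 < s" "s < 1" "(\<Sum>x\<in>UNIV. \<tau> $ x * v x powr s) < 1"
    using exists_powr_mean_less_1[of "($) \<tau>" v] states_sum[OF \<tau>] pos by (auto simp: v_def)
  define q where "q = (\<Sum>x\<in>UNIV. \<tau> $ x * v x powr s)"
  \<comment> \<open>If the product of the \<open>v x\<close> is at most 1, the first term on the
    right dominates; otherwise its power \<open>s\<close> is at least 1 and the second term does.
    The second terms sum to \<open>q ^ n\<close>.\<close>
  have pointwise: "prod_list (map (($) \<tau>) xs) \<le> exp d ^ length xs * prod_list (map (($) \<sigma>) xs)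
      + prod_list (map (\<lambda>x. \<tau> $ x * v x powr s) xs)" for xs
  proof (cases "\<forall>x\<in>set xs. \<tau> $ x \<noteq> 0")
    case True
    have eq: "prod_list (map (($) \<tau>) xs)
        = exp d ^ length xs * prod_list (map (($) \<sigma>) xs) * prod_list (map v xs)"
      using True
    proof (induction xs)
      case (Cons x xs)
      then have "\<tau> $ x = exp d * \<sigma> $ x * v x"
        using pos[of x] by (simp add: v_def exp_minus)
      then show ?case using Cons by simp
    qed simp
    have vpos: "0 < prod_list (map v xs)" and vpowr: "prod_list (map (\<lambda>x. v x powr s) xs) = prod_list (map v xs) powr s"
    proof -
      show "0 < prod_list (map v xs)" using True by (induction xs) (auto simp: v_def pos)
      show "prod_list (map (\<lambda>x. v x powr s) xs) = prod_list (map v xs) powr s"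
      proof -
        have "\<And>x. 0 \<le> v x" using states_nonneg[OF \<tau>] states_nonneg[OF \<sigma>] by (simp add: v_def)
        then show ?thesis by (induction xs) (auto simp: powr_mult prod_list_map_nonneg)
      qed
    qed
    have nn: "0 \<le> prod_list (map (($) \<tau>) xs)" "0 \<le> exp d ^ length xs * prod_list (map (($) \<sigma>) xs)"
      using states_nonneg[OF \<tau>] states_nonneg[OF \<sigma>] by (auto intro!: prod_list_map_nonneg mult_nonneg_nonneg)
    show ?thesis
    proof (cases "prod_list (map v xs) \<le> 1")
      case True
      have "0 \<le> prod_list (map (\<lambda>x. \<tau> $ x * v x powr s) xs)"
        using states_nonneg[OF \<tau>] by (auto intro!: prod_list_map_nonneg)
      moreover have "prod_list (map (($) \<tau>) xs) \<le> exp d ^ length xs * prod_list (map (($) \<sigma>) xs)"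
        unfolding eq using True nn(2) by (rule mult_left_le)
      ultimately show ?thesis by linarith
    next
      case False
      then have "1 \<le> prod_list (map v xs) powr s" using s by (simp add: ge_one_powr_ge_zero)
      then have "prod_list (map (($) \<tau>) xs) \<le> prod_list (map (($) \<tau>) xs) * prod_list (map v xs) powr s"
        using nn(1) mult_left_mono by fastforce
      then show ?thesis using nn(2) by (simp add: prod_list_map_mult vpowr)
    qed
  next
    case False
    then have "prod_list (map (($) \<tau>) xs) = 0" by (auto simp: prod_list_zero_iff)
    moreover have "0 \<le> exp d ^ length xs * prod_list (map (($) \<sigma>) xs)"
      "0 \<le> prod_list (map (\<lambda>x. \<tau> $ x * v x powr s) xs)"
      using states_nonneg[OF \<tau>] states_nonneg[OF \<sigma>] by (auto intro!: prod_list_map_nonneg mult_nonneg_nonneg)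
    ultimately show ?thesis by linarith
  qed
  show thesis
  proof (rule that[of q])
    show "0 \<le> q" unfolding q_def using states_nonneg[OF \<tau>] by (intro sum_nonneg) auto
    show "q < 1" using s by (simp add: q_def)
    fix T :: "nat \<Rightarrow> 'a list \<Rightarrow> real" and n
    assume T: "test_seq T"
    have T01: "0 \<le> T n xs" "T n xs \<le> 1" if "xs \<in> seqs n" for xs
      using T that by (auto simp: test_seq_def)
    have "expect n (prod_state n (\<lambda>_. \<tau>)) (T n)
        \<le> (\<Sum>xs\<in>seqs n. exp d ^ n * (prod_state n (\<lambda>_. \<sigma>) xs * T n xs)
            + prod_list (map (\<lambda>x. \<tau> $ x * v x powr s) xs))"
      unfolding expect_def
    proof (rule sum_mono)
      fix xs :: "'a list" assume xs: "xs \<in> seqs n"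
      have "prod_state n (\<lambda>_. \<tau>) xs * T n xs
        \<le> (exp d ^ n * prod_state n (\<lambda>_. \<sigma>) xs + prod_list (map (\<lambda>x. \<tau> $ x * v x powr s) xs)) * T n xs"
        using pointwise[of xs] xs T01(1)[OF xs]
        by (intro mult_right_mono) (auto simp: prod_state_iid seqs_def)
      also have "\<dots> = exp d ^ n * (prod_state n (\<lambda>_. \<sigma>) xs * T n xs)
          + prod_list (map (\<lambda>x. \<tau> $ x * v x powr s) xs) * T n xs" by (simp add: algebra_simps)
      also have "\<dots> \<le> exp d ^ n * (prod_state n (\<lambda>_. \<sigma>) xs * T n xs)
          + prod_list (map (\<lambda>x. \<tau> $ x * v x powr s) xs)"
        using T01[OF xs] states_nonneg[OF \<tau>]
        by (intro add_left_mono mult_left_le prod_list_map_nonneg) auto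
      finally show "prod_state n (\<lambda>_. \<tau>) xs * T n xs
        \<le> exp d ^ n * (prod_state n (\<lambda>_. \<sigma>) xs * T n xs)
          + prod_list (map (\<lambda>x. \<tau> $ x * v x powr s) xs)" .
    qed
    also have "\<dots> = exp d ^ n * expect n (prod_state n (\<lambda>_. \<sigma>)) (T n) + q ^ n"
      by (simp add: sum.distrib sum_seqs_prod_list q_def expect_def sum_distrib_left)
    finally show "expect n (prod_state n (\<lambda>_. \<tau>)) (T n)
       \<le> exp d ^ n * expect n (prod_state n (\<lambda>_. \<sigma>)) (T n) + q ^ n" .
  qed
qed

lemma err2_iid_singleton: "err2 (iid {\<sigma>}) T n = expect n (prod_state n (\<lambda>_. \<sigma>)) (T n)"
  by (simp add: err2_def iid_def)

text \<open>Passing from \<sigma> to \<tau> costs a factor \<open>exp d ^ n\<close> with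
  \<open>d\<close> just above \<open>kl \<tau> \<sigma>\<close>, which the faster decay under
  \<sigma> outweighs.\<close>

lemma acceptance_tendsto_0:
  fixes \<tau> \<sigma> :: "real^'a::finite"
  assumes \<tau>: "\<tau> \<in> states" and \<sigma>: "\<sigma> \<in> states" and supp: "supp \<tau> \<subseteq> supp \<sigma>"
    and T: "test_seq T" and rate: "ereal (kl \<tau> \<sigma>) < rate (err2 (iid {\<sigma>}) T)"
  shows "(\<lambda>n. expect n (prod_state n (\<lambda>_. \<tau>)) (T n)) \<longlonglongrightarrow> 0"
proof -
  obtain d' where d': "kl \<tau> \<sigma> < d'" "ereal d' < rate (err2 (iid {\<sigma>}) T)"
    using ereal_dense2[OF rate] by auto
  define d where "d = (kl \<tau> \<sigma> + d') / 2"
  have d: "kl \<tau> \<sigma> < d" "d < d'" using d'(1) by (auto simp: d_def)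
  obtain q where q: "0 \<le> q" "q < 1"
    "\<And>T n. test_seq T \<Longrightarrow> expect n (prod_state n (\<lambda>_. \<tau>)) (T n)
       \<le> exp d ^ n * expect n (prod_state n (\<lambda>_. \<sigma>)) (T n) + q ^ n"
    by (rule change_of_measure[OF \<tau> \<sigma> supp d(1)]) (rule that)
  have nn: "0 \<le> expect n (prod_state n (\<lambda>_. \<rho>)) (T n)" if "\<rho> \<in> states" for n \<rho>
    by (rule expect_test_bounds(1)[OF T prod_state_states_n]) (rule that)
  have "\<forall>\<^sub>F n in sequentially. err2 (iid {\<sigma>}) T n \<le> exp (- d') ^ n"
    using rate_gt_imp_eventually_le[OF d'(2)] nn[OF \<sigma>] by (simp add: err2_iid_singleton)
  then have upper: "\<forall>\<^sub>F n in sequentially. expect n (prod_state n (\<lambda>_. \<tau>)) (T n) \<le> exp (d - d') ^ n + q ^ n"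
  proof eventually_elim
    case (elim n)
    have "exp d ^ n * expect n (prod_state n (\<lambda>_. \<sigma>)) (T n) \<le> exp d ^ n * exp (- d') ^ n"
      using elim by (intro mult_left_mono) (auto simp: err2_iid_singleton)
    also have "\<dots> = exp (d - d') ^ n"
      by (simp add: power_mult_distrib[symmetric] exp_add[symmetric])
    finally show ?case using q(3)[OF T, of n] by linarith
  qed
  have "(\<lambda>n. exp (d - d') ^ n + q ^ n) \<longlonglongrightarrow> 0 + 0"
    using d(2) q(1,2) by (intro tendsto_add LIMSEQ_power_zero) simp_all
  then have lim: "(\<lambda>n. exp (d - d') ^ n + q ^ n) \<longlonglongrightarrow> 0" by simp
  show ?thesis
    using nn[OF \<tau>] by (intro tendsto_sandwich[OF _ upper tendsto_const lim] always_eventually allI)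
qed

lemma expect_complement:
  assumes "\<omega> \<in> states_n n"
  shows "expect n \<omega> (\<lambda>xs. 1 - f xs) = 1 - expect n \<omega> f"
  using assms by (simp add: expect_def states_n_def right_diff_distrib sum_subtractf)

lemma error_sum_not_tendsto_0:
  fixes \<tau> :: "real^'a::finite"
  assumes "\<tau> \<in> states" "(\<lambda>n. expect n (prod_state n (\<lambda>_. \<tau>)) (T n)) \<longlonglongrightarrow> 0"
    "(\<lambda>n. expect n (prod_state n (\<lambda>_. \<tau>)) (\<lambda>xs. 1 - T n xs)) \<longlonglongrightarrow> 0"
  shows False
proof -
  have "(\<lambda>n. expect n (prod_state n (\<lambda>_. \<tau>)) (T n)
      + expect n (prod_state n (\<lambda>_. \<tau>)) (\<lambda>xs. 1 - T n xs)) \<longlonglongrightarrow> 0 + 0"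
    using assms(2,3) by (rule tendsto_add)
  moreover have "expect n (prod_state n (\<lambda>_. \<tau>)) (\<lambda>xs. 1 - T n xs)
      = 1 - expect n (prod_state n (\<lambda>_. \<tau>)) (T n)" for n
    by (rule expect_complement) (rule prod_state_states_n, rule assms(1))
  ultimately have "(\<lambda>n::nat. 1::real) \<longlonglongrightarrow> 0" by simp
  then show False using LIMSEQ_unique tendsto_const by fastforce
qed

text \<open>Otherwise the acceptance and the rejection probability under \<tau> would both tend to
  0, although they sum to 1.\<close>

lemma no_test_beats_third_state:
  fixes \<tau> \<rho> \<sigma> :: "real^'a::finite"
  assumes "\<tau> \<in> states" "\<rho> \<in> states" "\<sigma> \<in> states" "supp \<tau> \<subseteq> supp \<rho>" "supp \<tau> \<subseteq> supp \<sigma>" "test_seq T"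
    and "ereal (kl \<tau> \<sigma>) < rate (err2 (iid {\<sigma>}) T)" "ereal (kl \<tau> \<rho>) < rate (err1 (iid {\<rho>}) T)"
  shows False
  using error_sum_not_tendsto_0[OF assms(1) acceptance_tendsto_0[OF assms(1,3,5,6,7)]]
    acceptance_tendsto_0[OF assms(1,2,4) test_seq_complement[OF assms(6)]] assms(8)
  by (simp add: err1_eq)

text \<open>Since \<open>0 powr 0 = 0\<close>, only letters in both supports contribute, at orders 0
  and 1 too. The affinity is thus a finite sum of exponentials and continuous in the order.\<close>

lemma affinity_eq_exp_sum:
  assumes "\<And>x. 0 \<le> A $ x" "\<And>x. 0 \<le> B $ x"
  shows "affinity a A B = (\<Sum>x | A $ x \<noteq> 0 \<and> B $ x \<noteq> 0. exp (a * ln (A $ x) + (1 - a) * ln (B $ x)))"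
proof -
  have "affinity a A B = (\<Sum>x\<in>UNIV. if A $ x \<noteq> 0 \<and> B $ x \<noteq> 0
      then exp (a * ln (A $ x) + (1 - a) * ln (B $ x)) else 0)"
    unfolding affinity_def by (intro sum.cong refl) (auto simp: powr_def exp_add)
  then show ?thesis by (simp add: sum.If_cases)
qed

lemma continuous_on_affinity_order:
  assumes "\<And>x. 0 \<le> A $ x" "\<And>x. 0 \<le> B $ x"
  shows "continuous_on I (\<lambda>a. affinity a A B)"
  unfolding affinity_eq_exp_sum[OF assms] by (intro continuous_intros)

text \<open>The divergences see inner orders only, but a minimising order is guaranteed to exist
  only on the closed interval.\<close>

lemma affinity_ge_on_closed_interval:
  assumes "\<And>x. 0 \<le> A $ x" "\<And>x. 0 \<le> B $ x" "\<And>a. a \<in> {0<..<1} \<Longrightarrow> m \<le> affinity a A B" "a \<in> {0..1}"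
  shows "m \<le> affinity a A B"
proof -
  have "closure {0<..<1::real} = {0..1}" by simp
  then show ?thesis
    using continuous_ge_on_closure[of "{0<..<1}" "\<lambda>a. affinity a A B" a m]
      continuous_on_affinity_order[OF assms(1,2)] assms(3,4) by metis
qed

text \<open>The derivative vanishes at an inner minimum, is nonnegative at 0 and nonpositive at 1.
  The factors \<open>a\<close> and \<open>1 - a\<close> unite the three cases, and they are the
  factors that occur in the relative entropies of the tilted density.\<close>

lemma interval_min_derivative:
  fixes f :: "real \<Rightarrow> real"
  assumes "(f has_real_derivative D) (at a)" "a \<in> {0..1}" "\<And>b. b \<in> {0..1} \<Longrightarrow> f a \<le> f b"
  shows "a * D \<le> 0" "0 \<le> (1 - a) * D"
proof -
  show "a * D \<le> 0"
  proof (rule ccontr)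
    assume "\<not> a * D \<le> 0"
    then have "0 < a" "0 < D" using assms(2) by (auto simp: mult_le_0_iff)
    then obtain d where d: "0 < d" "\<And>h. 0 < h \<Longrightarrow> h < d \<Longrightarrow> f (a - h) < f a"
      using DERIV_pos_inc_left[OF assms(1)] by auto
    define h where "h = min d a / 2"
    have "0 < h" "h < d" "h < a" using d(1) \<open>0 < a\<close> by (auto simp: h_def min_def)
    then show False using d(2)[of h] assms(3)[of "a - h"] assms(2) by auto
  qed
  show "0 \<le> (1 - a) * D"
  proof (rule ccontr)
    assume "\<not> 0 \<le> (1 - a) * D"
    then have "a < 1" "D < 0" using assms(2) by (auto simp: zero_le_mult_iff)
    then obtain d where d: "0 < d" "\<And>h. 0 < h \<Longrightarrow> h < d \<Longrightarrow> f (a + h) < f a"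
      using DERIV_neg_dec_right[OF assms(1)] by auto
    define h where "h = min d (1 - a) / 2"
    have "0 < h" "h < d" "a + h < 1" using d(1) \<open>a < 1\<close> by (auto simp: h_def min_def field_simps)
    then show False using d(2)[of h] assms(3)[of "a + h"] assms(2) by auto
  qed
qed

text \<open>The tilted density \<open>\<rho>\<^sup>a \<sigma>\<^sup>1\<^sup>-\<^sup>a\<close>, normalised, at a minimiser \<open>a\<close> of the affinity.\<close>

lemma tilted_state:
  fixes \<rho> \<sigma> :: "real^'a::finite"
  assumes \<rho>: "\<rho> \<in> states" and \<sigma>: "\<sigma> \<in> states"
    and gt: "\<And>a. a \<in> {0..1} \<Longrightarrow> 1 < affinity a (exp c *\<^sub>R \<rho>) (exp r *\<^sub>R \<sigma>)"
  obtains \<tau> where "\<tau> \<in> states" "supp \<tau> \<subseteq> supp \<rho>" "supp \<tau> \<subseteq> supp \<sigma>" "kl \<tau> \<sigma> < r" "kl \<tau> \<rho> < c"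
proof -
  define X where "X = {x. \<rho> $ x \<noteq> 0 \<and> \<sigma> $ x \<noteq> 0}"
  define lA where "lA x = c + ln (\<rho> $ x)" for x
  define lB where "lB x = r + ln (\<sigma> $ x)" for x
  define w where "w a x = exp (a * lA x + (1 - a) * lB x)" for a x
  define G where "G a = (\<Sum>x\<in>X. w a x)" for a
  have pos: "0 < \<rho> $ x \<and> 0 < \<sigma> $ x" if "x \<in> X" for x
    using that states_nonneg[OF \<rho>, of x] states_nonneg[OF \<sigma>, of x] by (auto simp: X_def)
  have G_eq: "affinity a (exp c *\<^sub>R \<rho>) (exp r *\<^sub>R \<sigma>) = G a" for a
    unfolding G_def w_def lA_def lB_def
    by (subst affinity_eq_exp_sum)
       (use states_nonneg[OF \<rho>] states_nonneg[OF \<sigma>] pos in \<open>auto simp: X_def ln_mult intro!: sum.cong\<close>)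
  have "continuous_on {0..1} G"
    unfolding G_def w_def by (intro continuous_intros)
  then obtain a where a: "a \<in> {0..1}" "\<And>b. b \<in> {0..1} \<Longrightarrow> G a \<le> G b"
    using continuous_attains_inf[of "{0..1}" G] by auto
  define D where "D = (\<Sum>x\<in>X. w a x * (lA x - lB x))"
  have "(G has_real_derivative D) (at a)"
    unfolding G_def D_def w_def by (auto intro!: derivative_eq_intros sum.cong simp: algebra_simps)
  note D = interval_min_derivative[OF this a]
  have G1: "1 < G a" using gt[OF a(1)] G_eq by simp
  define \<tau> :: "real^'a" where "\<tau> = (\<chi> x. if x \<in> X then w a x / G a else 0)"
  have \<tau>_sum: "(\<Sum>x\<in>UNIV. \<tau> $ x * f x) = (\<Sum>x\<in>X. w a x * f x) / G a" for f
  proof -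
    have "(\<Sum>x\<in>UNIV. \<tau> $ x * f x) = (\<Sum>x\<in>UNIV. if x \<in> X then w a x * f x / G a else 0)"
      by (intro sum.cong refl) (auto simp: \<tau>_def)
    then show ?thesis by (simp add: sum.If_cases sum_divide_distrib)
  qed
  have \<tau>: "\<tau> \<in> states"
    using \<tau>_sum[of "\<lambda>_. 1"] G1 by (auto simp: states_def G_def[symmetric]) (simp add: \<tau>_def w_def)
  have ln_tau: "ln (\<tau> $ x) = a * lA x + (1 - a) * lB x - ln (G a)" if "x \<in> X" for x
    using that G1 by (simp add: \<tau>_def w_def ln_div)
  have \<tau>_pos: "0 < \<tau> $ x" if "x \<in> X" for x
    using that G1 by (simp add: \<tau>_def w_def)
  \<comment> \<open>Both log-ratios below are affine in \<open>lA x - lB x\<close>. The relative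
    entropies become \<open>r - ln (G a) + a * D / G a\<close> and
    \<open>c - ln (G a) + (a - 1) * D / G a\<close>; the terms with \<open>D\<close> are nonpositive
    by minimality, and \<open>G a > 1\<close> gives strictness.\<close>
  have wG: "(\<Sum>x\<in>X. w a x * (u * (lA x - lB x) + v)) = u * D + v * G a" for u v
    by (simp add: D_def G_def sum_distrib_left sum.distrib[symmetric] algebra_simps)
  have "kl \<tau> \<sigma> = (\<Sum>x\<in>X. w a x * ln (\<tau> $ x / \<sigma> $ x)) / G a"
    unfolding kl_def by (rule \<tau>_sum)
  also have "\<dots> = (\<Sum>x\<in>X. w a x * (a * (lA x - lB x) + (r - ln (G a)))) / G a"
  proof -
    have "ln (\<tau> $ x / \<sigma> $ x) = a * (lA x - lB x) + (r - ln (G a))" if "x \<in> X" for x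
      using pos[OF that] \<tau>_pos[OF that] ln_tau[OF that]
      by (simp add: ln_div lB_def algebra_simps)
    then show ?thesis by simp
  qed
  also have "\<dots> = a * D / G a + (r - ln (G a))"
    unfolding wG using G1 by (simp add: add_divide_distrib)
  also have "\<dots> < r" using D(1) G1 by (smt (verit) divide_nonpos_pos ln_gt_zero)
  finally have 1: "kl \<tau> \<sigma> < r" .
  have "kl \<tau> \<rho> = (\<Sum>x\<in>X. w a x * ln (\<tau> $ x / \<rho> $ x)) / G a"
    unfolding kl_def by (rule \<tau>_sum)
  also have "\<dots> = (\<Sum>x\<in>X. w a x * ((a - 1) * (lA x - lB x) + (c - ln (G a)))) / G a"
  proof -
    have "ln (\<tau> $ x / \<rho> $ x) = (a - 1) * (lA x - lB x) + (c - ln (G a))" if "x \<in> X" for x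
      using pos[OF that] \<tau>_pos[OF that] ln_tau[OF that]
      by (simp add: ln_div lA_def algebra_simps)
    then show ?thesis by simp
  qed
  also have "\<dots> = (a - 1) * D / G a + (c - ln (G a))"
    unfolding wG using G1 by (simp add: add_divide_distrib)
  also have "\<dots> < c"
  proof -
    have "(a - 1) * D \<le> 0" using D(2) by (simp add: algebra_simps)
    then show ?thesis using G1 by (smt (verit) divide_nonpos_pos ln_gt_zero)
  qed
  finally have 2: "kl \<tau> \<rho> < c" .
  show thesis
    by (rule that[OF \<tau> _ _ 1 2]) (auto simp: supp_def \<tau>_def X_def)
qed

section \<open>Divergences in terms of the affinity\<close>

lemma ereal_le_renyi_div_0_iff:
  assumes "\<sigma> \<in> states"
  shows "ereal r \<le> renyi_div_0 \<rho> \<sigma> \<longleftrightarrow> exp r * (\<Sum>x\<in>supp \<rho>. \<sigma> $ x) \<le> 1"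
proof -
  have nn: "0 \<le> (\<Sum>x\<in>supp \<rho>. \<sigma> $ x)" using states_nonneg[OF assms] by (intro sum_nonneg) auto
  have "ereal r \<le> renyi_div_0 \<rho> \<sigma> \<longleftrightarrow> elog (\<Sum>x\<in>supp \<rho>. \<sigma> $ x) \<le> ereal (- r)"
    unfolding renyi_div_0_def by (metis ereal_minus_le_minus ereal_uminus_uminus uminus_ereal.simps(1))
  also have "\<dots> \<longleftrightarrow> (\<Sum>x\<in>supp \<rho>. \<sigma> $ x) \<le> exp (- r)" using elog_le_iff[OF nn] .
  also have "\<dots> \<longleftrightarrow> exp r * (\<Sum>x\<in>supp \<rho>. \<sigma> $ x) \<le> 1" by (simp add: exp_minus field_simps)
  finally show ?thesis .
qed

lemma ereal_eq_renyi_div_0_iff: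
  assumes "\<sigma> \<in> states"
  shows "ereal r = renyi_div_0 \<rho> \<sigma> \<longleftrightarrow> exp r * (\<Sum>x\<in>supp \<rho>. \<sigma> $ x) = 1"
proof -
  have nn: "0 \<le> (\<Sum>x\<in>supp \<rho>. \<sigma> $ x)" using states_nonneg[OF assms] by (intro sum_nonneg) auto
  show ?thesis
  proof (cases "(\<Sum>x\<in>supp \<rho>. \<sigma> $ x) = 0")
    case True
    then show ?thesis by (simp add: renyi_div_0_def elog_def)
  next
    case False
    then have pos: "0 < (\<Sum>x\<in>supp \<rho>. \<sigma> $ x)" using nn by simp
    then have "ereal r = renyi_div_0 \<rho> \<sigma> \<longleftrightarrow> ln (\<Sum>x\<in>supp \<rho>. \<sigma> $ x) = - r"
      by (auto simp: renyi_div_0_def elog_def)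
    also have "\<dots> \<longleftrightarrow> (\<Sum>x\<in>supp \<rho>. \<sigma> $ x) = exp (- r)" using pos by (metis exp_ln ln_exp)
    finally show ?thesis by (simp add: exp_minus field_simps)
  qed
qed

text \<open>Relies on \<open>0 powr 0 = 0\<close>. It identifies \<open>renyi_div_0\<close> as the
  quantity that governs order 0.\<close>

lemma affinity_0:
  assumes "\<And>x. 0 \<le> B $ x"
  shows "affinity 0 A B = (\<Sum>x\<in>supp A. B $ x)"
proof -
  have "affinity 0 A B = (\<Sum>x\<in>UNIV. if x \<in> supp A then B $ x else 0)"
    unfolding affinity_def using assms by (intro sum.cong refl) (auto simp: supp_def)
  then show ?thesis by (simp add: sum.If_cases)
qed

lemma affinity_0_scaled:
  assumes "\<sigma> \<in> states"
  shows "affinity 0 (exp c *\<^sub>R \<rho>) (exp r *\<^sub>R \<sigma>) = exp r * (\<Sum>x\<in>supp \<rho>. \<sigma> $ x)"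
proof -
  have "supp (exp c *\<^sub>R \<rho>) = supp \<rho>" by (auto simp: supp_def)
  then show ?thesis
    using assms by (simp add: states_nonneg affinity_0 sum_distrib_left)
qed

lemma affinity_exp:
  assumes "\<rho> \<in> states" "\<sigma> \<in> states"
  shows "affinity a (exp c *\<^sub>R \<rho>) (exp r *\<^sub>R \<sigma>) = exp (c * a + r * (1 - a)) * affinity a \<rho> \<sigma>"
  using affinity_scaleR[of "exp c" "exp r" \<rho> \<sigma> a] assms
  by (simp add: states_nonneg powr_def exp_add mult.commute)

lemma affinity_exp_less_1_iff:
  assumes "\<rho> \<in> states" "\<sigma> \<in> states" "affinity a \<rho> \<sigma> \<noteq> 0"
  shows "affinity a (exp c *\<^sub>R \<rho>) (exp r *\<^sub>R \<sigma>) < 1 \<longleftrightarrow>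
    c * a + r * (1 - a) + ln (affinity a \<rho> \<sigma>) < 0"
proof -
  have "0 < affinity a \<rho> \<sigma>" using assms(3) affinity_nonneg[of a \<rho> \<sigma>] by simp
  then have "affinity a (exp c *\<^sub>R \<rho>) (exp r *\<^sub>R \<sigma>) = exp (c * a + r * (1 - a) + ln (affinity a \<rho> \<sigma>))"
    by (simp add: affinity_exp[OF assms(1,2)] exp_add)
  then show ?thesis by simp
qed

lemma renyi_div_eq: "renyi_div a \<rho> \<sigma> = ereal (1 / (a - 1)) * elog (affinity a \<rho> \<sigma>)"
  by (simp add: renyi_div_def affinity_def)

text \<open>Order by order: multiplied by the positive \<open>a\<close>, the inequality says that
  \<open>c * a + r * (1 - a) + ln (affinity a \<rho> \<sigma>)\<close>, the logarithm of the scaled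
  affinity, is negative. For affinity 0 the Renyi divergence is infinite and both sides are
  true.\<close>

lemma less_hoeffding_div_iff:
  assumes "\<rho> \<in> states" "\<sigma> \<in> states"
  shows "ereal c < hoeffding_div r \<rho> \<sigma> \<longleftrightarrow>
    (\<exists>a\<in>{0<..<1}. affinity a (exp c *\<^sub>R \<rho>) (exp r *\<^sub>R \<sigma>) < 1)"
proof -
  have "ereal c < ereal ((a - 1) / a) * (ereal r - renyi_div a \<rho> \<sigma>) \<longleftrightarrow>
      affinity a (exp c *\<^sub>R \<rho>) (exp r *\<^sub>R \<sigma>) < 1" if a: "0 < a" "a < 1" for a
  proof (cases "affinity a \<rho> \<sigma> = 0")
    case True
    have "1 / (a - 1) < 0" "(a - 1) / a < 0" using a by (auto simp: divide_neg_pos)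
    then show ?thesis
      using True a by (simp add: renyi_div_eq elog_def affinity_exp[OF assms])
  next
    case False
    define l where "l = ln (affinity a \<rho> \<sigma>)"
    have "ereal ((a - 1) / a) * (ereal r - renyi_div a \<rho> \<sigma>) = ereal ((a - 1) / a * (r - 1 / (a - 1) * l))"
      using False by (simp add: renyi_div_eq elog_def l_def)
    also have "(a - 1) / a * (r - 1 / (a - 1) * l) = ((a - 1) * r - l) / a"
      using a by (simp add: field_simps)
    finally show ?thesis
      using a by (simp add: affinity_exp_less_1_iff[OF assms False] l_def[symmetric] pos_less_divide_eq)
        (auto simp: algebra_simps)
  qed
  then show ?thesis unfolding hoeffding_div_def less_SUP_iff by auto
qed

lemma less_chernoff_div_iff:
  assumes "\<rho> \<in> states" "\<sigma> \<in> states"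
  shows "ereal c < chernoff_div \<rho> \<sigma> \<longleftrightarrow>
    (\<exists>a\<in>{0<..<1}. affinity a (exp c *\<^sub>R \<rho>) (exp c *\<^sub>R \<sigma>) < 1)"
proof -
  have "ereal c < ereal (1 - a) * renyi_div a \<rho> \<sigma> \<longleftrightarrow>
      affinity a (exp c *\<^sub>R \<rho>) (exp c *\<^sub>R \<sigma>) < 1" if a: "0 < a" "a < 1" for a
  proof (cases "affinity a \<rho> \<sigma> = 0")
    case True
    have "1 / (a - 1) < 0" using a by auto
    then show ?thesis
      using True a by (simp add: renyi_div_eq elog_def affinity_exp[OF assms])
  next
    case False
    define l where "l = ln (affinity a \<rho> \<sigma>)"
    have "ereal (1 - a) * renyi_div a \<rho> \<sigma> = ereal ((1 - a) * (1 / (a - 1) * l))"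
      using False by (simp add: renyi_div_eq elog_def l_def)
    also have "(1 - a) * (1 / (a - 1) * l) = - l"
      using a by (simp add: field_simps)
    finally show ?thesis
      using a by (simp add: affinity_exp_less_1_iff[OF assms False] l_def[symmetric])
        (auto simp: algebra_simps)
  qed
  then show ?thesis unfolding chernoff_div_def less_SUP_iff by auto
qed

text \<open>The derivative of the affinity at order 1 is the relative entropy, up to sign and shift;
  if \<open>supp \<rho>\<close> is not contained in \<open>supp \<sigma>\<close>, the affinity itself is smaller than 1 there.\<close>

lemma less_relative_entropy_imp_affinity:
  assumes \<rho>: "\<rho> \<in> states" and \<sigma>: "\<sigma> \<in> states" and "ereal r < relative_entropy \<rho> \<sigma>"
  shows "\<exists>a\<in>{0<..<1}. affinity a (exp 0 *\<^sub>R \<rho>) (exp r *\<^sub>R \<sigma>) < 1"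
proof (cases "supp \<rho> \<subseteq> supp \<sigma>")
  case True
  have pos: "0 < \<rho> $ x \<and> 0 < \<sigma> $ x" if "\<rho> $ x \<noteq> 0" for x
    using that True states_nonneg[OF \<rho>, of x] states_nonneg[OF \<sigma>, of x] unfolding supp_def by force
  \<comment> \<open>The inverse likelihood ratio: the mean of \<open>u x powr s\<close> under \<rho>
    is the affinity at order \<open>1 - s\<close>.\<close>
  define u where "u x = exp r * \<sigma> $ x / \<rho> $ x" for x
  have "(\<Sum>x\<in>UNIV. \<rho> $ x * ln (u x)) = (\<Sum>x\<in>UNIV. \<rho> $ x * r - \<rho> $ x * ln (\<rho> $ x / \<sigma> $ x))"
  proof (rule sum.cong[OF refl])
    fix x
    show "\<rho> $ x * ln (u x) = \<rho> $ x * r - \<rho> $ x * ln (\<rho> $ x / \<sigma> $ x)"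
    proof (cases "\<rho> $ x = 0")
      case False
      then have "ln (u x) = r - ln (\<rho> $ x / \<sigma> $ x)"
        using pos[OF False] by (simp add: u_def ln_div ln_mult)
      then show ?thesis by (simp add: right_diff_distrib)
    qed simp
  qed
  also have "\<dots> = r - kl \<rho> \<sigma>"
    by (simp add: sum_subtractf kl_def sum_distrib_right[symmetric] states_sum[OF \<rho>])
  also have "\<dots> < 0" using assms(3) True by (simp add: relative_entropy_def kl_def)
  finally obtain s where s: "0 < s" "s < 1" "(\<Sum>x\<in>UNIV. \<rho> $ x * u x powr s) < 1"
    using exists_powr_mean_less_1[of "($) \<rho>" u] states_sum[OF \<rho>] pos by (auto simp: u_def)
  have "\<rho> $ x * u x powr s = (\<rho> $ x) powr (1 - s) * (exp r * \<sigma> $ x) powr s" for x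
    using pos[of x] by (cases "\<rho> $ x = 0") (auto simp: u_def powr_divide powr_diff)
  then have "affinity (1 - s) (exp 0 *\<^sub>R \<rho>) (exp r *\<^sub>R \<sigma>) < 1"
    using s(3) by (simp add: affinity_def)
  then show ?thesis using s by (intro bexI[of _ "1 - s"]) auto
next
  case False
  then obtain y where y: "\<rho> $ y \<noteq> 0" "\<sigma> $ y = 0" by (auto simp: supp_def)
  define B where "B = exp r *\<^sub>R \<sigma>"
  have nn: "\<And>x. 0 \<le> \<rho> $ x" "\<And>x. 0 \<le> B $ x"
    using states_nonneg[OF \<rho>] states_nonneg[OF \<sigma>] by (auto simp: B_def)
  have "affinity 1 \<rho> B = affinity 0 B \<rho>" by (simp add: affinity_commute[of 1])
  also have "\<dots> = (\<Sum>x\<in>supp B. \<rho> $ x)" using nn(1) by (rule affinity_0)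
  also have "\<dots> < (\<Sum>x\<in>UNIV. \<rho> $ x)"
    by (rule sum_strict_mono2[of _ _ y]) (use y nn in \<open>auto simp: supp_def B_def order_le_less\<close>)
  finally have "affinity 1 \<rho> B < 1" by (simp add: states_sum[OF \<rho>])
  then have "\<not> (\<forall>a\<in>{0<..<1}. 1 \<le> affinity a \<rho> B)"
    using affinity_ge_on_closed_interval[OF nn, of 1 1] by force
  then show ?thesis by (auto simp: B_def not_le)
qed

section \<open>Exponents of a pair are bounded by its divergence\<close>

lemma affinity_exp_mono:
  assumes "\<rho> \<in> states" "\<sigma> \<in> states" "1 \<le> affinity a (exp c *\<^sub>R \<rho>) (exp r *\<^sub>R \<sigma>)"
  shows "exp ((c' - c) * a + (r' - r) * (1 - a)) \<le> affinity a (exp c' *\<^sub>R \<rho>) (exp r' *\<^sub>R \<sigma>)"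
proof -
  have "affinity a (exp c' *\<^sub>R \<rho>) (exp r' *\<^sub>R \<sigma>)
    = exp ((c' - c) * a + (r' - r) * (1 - a)) * affinity a (exp c *\<^sub>R \<rho>) (exp r *\<^sub>R \<sigma>)"
    unfolding affinity_exp[OF assms(1,2)] mult.assoc[symmetric] exp_add[symmetric]
    by (simp add: algebra_simps)
  then show ?thesis using assms(3) by simp
qed

lemma affinity_scaled_closed_interval:
  assumes "\<rho> \<in> states" "\<sigma> \<in> states"
    and "\<And>a. a \<in> {0<..<1} \<Longrightarrow> m \<le> affinity a (exp c *\<^sub>R \<rho>) (exp r *\<^sub>R \<sigma>)" "a \<in> {0..1}"
  shows "m \<le> affinity a (exp c *\<^sub>R \<rho>) (exp r *\<^sub>R \<sigma>)"
  using assms by (intro affinity_ge_on_closed_interval[where a = a]) (auto simp: states_nonneg)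

text \<open>Here \<rho> itself serves as the third density: its acceptance probability would tend to
  0 together with its rejection probability.\<close>

lemma stein_exp_simple_le:
  fixes \<rho> \<sigma> :: "real^'a::finite"
  assumes \<rho>: "\<rho> \<in> states" and \<sigma>: "\<sigma> \<in> states"
  shows "e_simple stein_exp \<rho> \<sigma> \<le> relative_entropy \<rho> \<sigma>"
  unfolding e_simple_def e_iid_def stein_exp_def
proof (rule SUP_least, clarsimp)
  fix r and T :: "nat \<Rightarrow> 'a list \<Rightarrow> real"
  assume T: "test_seq T" "ereal r \<le> rate (err2 (iid {\<sigma>}) T)" and err1: "err1 (iid {\<rho>}) T \<longlonglongrightarrow> 0"
  show "ereal r \<le> relative_entropy \<rho> \<sigma>"
  proof (rule ccontr)
    assume "\<not> ereal r \<le> relative_entropy \<rho> \<sigma>"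
    then have supp: "supp \<rho> \<subseteq> supp \<sigma>" and "kl \<rho> \<sigma> < r"
      by (auto simp: relative_entropy_def kl_def split: if_splits)
    then have "ereal (kl \<rho> \<sigma>) < rate (err2 (iid {\<sigma>}) T)" using less_le_trans[OF _ T(2)] by simp
    then have "(\<lambda>n. expect n (prod_state n (\<lambda>_. \<rho>)) (T n)) \<longlonglongrightarrow> 0"
      by (rule acceptance_tendsto_0[OF \<rho> \<sigma> supp T(1)])
    moreover have "(\<lambda>n. expect n (prod_state n (\<lambda>_. \<rho>)) (\<lambda>xs. 1 - T n xs)) \<longlonglongrightarrow> 0"
      using err1 unfolding err1_eq err2_iid_singleton .
    ultimately show False by (rule error_sum_not_tendsto_0[OF \<rho>])
  qed
qed

text \<open>Raising an intermediate value \<open>c\<close> to \<open>r'\<close> multiplies the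
  affinity by \<open>exp ((r' - c) * a)\<close>, which gives the strictness required by
  \<open>tilted_state\<close> for \<open>a > 0\<close>. At \<open>a = 0\<close> nothing is gained,
  and \<open>ne\<close> has to exclude the value 1.\<close>

lemma direct_exp_simple_le:
  fixes \<rho> \<sigma> :: "real^'a::finite"
  assumes \<rho>: "\<rho> \<in> states" and \<sigma>: "\<sigma> \<in> states" and ne: "ereal r \<noteq> renyi_div_0 \<rho> \<sigma>"
  shows "e_simple (direct_exp r) \<rho> \<sigma> \<le> hoeffding_div r \<rho> \<sigma>"
  unfolding e_simple_def e_iid_def direct_exp_def
proof (rule SUP_least, clarsimp)
  fix r' and T :: "nat \<Rightarrow> 'a list \<Rightarrow> real"
  assume T: "test_seq T" "ereal r \<le> rate (err2 (iid {\<sigma>}) T)" "ereal r' \<le> rate (err1 (iid {\<rho>}) T)"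
  show "ereal r' \<le> hoeffding_div r \<rho> \<sigma>"
  proof (rule ccontr)
    assume "\<not> ereal r' \<le> hoeffding_div r \<rho> \<sigma>"
    then have "hoeffding_div r \<rho> \<sigma> < ereal r'" by simp
    then obtain c where c: "hoeffding_div r \<rho> \<sigma> < ereal c" "c < r'"
      using ereal_dense2 by force
    then have ge: "1 \<le> affinity a (exp c *\<^sub>R \<rho>) (exp r *\<^sub>R \<sigma>)" if "a \<in> {0<..<1}" for a
      using less_hoeffding_div_iff[OF \<rho> \<sigma>, of c r] that by (auto simp: not_less[symmetric])
    have "1 < affinity a (exp r' *\<^sub>R \<rho>) (exp r *\<^sub>R \<sigma>)" if "a \<in> {0..1}" for a
    proof -
      have ge': "1 \<le> affinity a (exp c *\<^sub>R \<rho>) (exp r *\<^sub>R \<sigma>)"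
        using affinity_scaled_closed_interval[OF \<rho> \<sigma> ge that] .
      show ?thesis
      proof (cases "a = 0")
        case True
        then show ?thesis
          using ge' ne by (simp add: affinity_0_scaled[OF \<sigma>] ereal_eq_renyi_div_0_iff[OF \<sigma>])
      next
        case False
        then have "1 < exp ((r' - c) * a)" using c(2) that by simp
        moreover have "exp ((r' - c) * a) \<le> affinity a (exp r' *\<^sub>R \<rho>) (exp r *\<^sub>R \<sigma>)"
          using affinity_exp_mono[OF \<rho> \<sigma> ge', of r' r] by simp
        ultimately show ?thesis by (rule less_le_trans)
      qed
    qed
    then obtain \<tau> where "\<tau> \<in> states" "supp \<tau> \<subseteq> supp \<rho>" "supp \<tau> \<subseteq> supp \<sigma>" "kl \<tau> \<sigma> < r" "kl \<tau> \<rho> < r'"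
      by (rule tilted_state[OF \<rho> \<sigma>])
    then show False
      using no_test_beats_third_state[of \<tau> \<rho> \<sigma> T, OF _ \<rho> \<sigma> _ _ T(1)]
        less_le_trans[OF _ T(2)] less_le_trans[OF _ T(3)] by simp
  qed
qed

text \<open>Both scalings grow from \<open>c\<close> to \<open>r\<close>, so the gain
  \<open>exp (r - c)\<close> is the same at every order, including 0, and there is no exceptional
  value.\<close>

lemma chernoff_exp_simple_le:
  fixes \<rho> \<sigma> :: "real^'a::finite"
  assumes \<rho>: "\<rho> \<in> states" and \<sigma>: "\<sigma> \<in> states"
  shows "e_simple chernoff_exp \<rho> \<sigma> \<le> chernoff_div \<rho> \<sigma>"
  unfolding e_simple_def e_iid_def chernoff_exp_def
proof (rule SUP_least, clarsimp)
  fix r and T :: "nat \<Rightarrow> 'a list \<Rightarrow> real"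
  assume T: "test_seq T" "ereal r \<le> rate (err2 (iid {\<sigma>}) T)" "ereal r \<le> rate (err1 (iid {\<rho>}) T)"
  show "ereal r \<le> chernoff_div \<rho> \<sigma>"
  proof (rule ccontr)
    assume "\<not> ereal r \<le> chernoff_div \<rho> \<sigma>"
    then have "chernoff_div \<rho> \<sigma> < ereal r" by simp
    then obtain c where c: "chernoff_div \<rho> \<sigma> < ereal c" "c < r"
      using ereal_dense2 by force
    then have ge: "1 \<le> affinity a (exp c *\<^sub>R \<rho>) (exp c *\<^sub>R \<sigma>)" if "a \<in> {0<..<1}" for a
      using less_chernoff_div_iff[OF \<rho> \<sigma>, of c] that by (auto simp: not_less[symmetric])
    have "1 < affinity a (exp r *\<^sub>R \<rho>) (exp r *\<^sub>R \<sigma>)" if "a \<in> {0..1}" for a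
    proof -
      have "1 < exp ((r - c) * a + (r - c) * (1 - a))" using c(2) by (simp add: algebra_simps)
      then show ?thesis
        using affinity_exp_mono[OF \<rho> \<sigma> affinity_scaled_closed_interval[OF \<rho> \<sigma> ge that], of r r]
        by linarith
    qed
    then obtain \<tau> where "\<tau> \<in> states" "supp \<tau> \<subseteq> supp \<rho>" "supp \<tau> \<subseteq> supp \<sigma>" "kl \<tau> \<sigma> < r" "kl \<tau> \<rho> < r"
      by (rule tilted_state[OF \<rho> \<sigma>])
    then show False
      using no_test_beats_third_state[of \<tau> \<rho> \<sigma> T, OF _ \<rho> \<sigma> _ _ T(1)]
        less_le_trans[OF _ T(2)] less_le_trans[OF _ T(3)] by simp
  qed
qed

text \<open>Repairs a pair whose affinity may be exactly 1 at order 0: mixing in a pair with a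
  larger value there makes it strict. By concavity the mixture loses at most a factor
  \<open>1 - t\<close> at the other orders, and the increase from \<open>c\<close> to
  \<open>c'\<close> pays for this.\<close>

lemma mix_pairs:
  fixes \<rho> \<sigma> :: "real^'a::finite"
  assumes st: "\<rho> \<in> states" "\<sigma> \<in> states" "\<rho>0 \<in> states" "\<sigma>0 \<in> states" and c: "c < c'"
    and ge: "\<And>a. a \<in> {0<..<1} \<Longrightarrow> 1 \<le> affinity a (exp c *\<^sub>R \<rho>) (exp r *\<^sub>R \<sigma>)"
    and gt: "1 < exp r * (\<Sum>x\<in>supp \<rho>0. \<sigma>0 $ x)"
  obtains t where "0 < t" "t < 1"
    "\<And>a. a \<in> {0<..<1} \<Longrightarrow> 1 \<le> affinity a (exp c' *\<^sub>R ((1 - t) *\<^sub>R \<rho> + t *\<^sub>R \<rho>0))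
      (exp r *\<^sub>R ((1 - t) *\<^sub>R \<sigma> + t *\<^sub>R \<sigma>0))"
    "1 < exp r * (\<Sum>x\<in>supp ((1 - t) *\<^sub>R \<rho> + t *\<^sub>R \<rho>0). ((1 - t) *\<^sub>R \<sigma> + t *\<^sub>R \<sigma>0) $ x)"
proof -
  define g where "g a = affinity a (exp c' *\<^sub>R \<rho>0) (exp r *\<^sub>R \<sigma>0)" for a
  have "continuous_on UNIV g"
    unfolding g_def using st by (intro continuous_on_affinity_order) (auto simp: states_nonneg)
  then have "isCont g 0" by (simp add: continuous_on_eq_continuous_at)
  moreover have "1 < g 0" using gt by (simp add: g_def affinity_0_scaled[OF st(4)])
  ultimately have "\<forall>\<^sub>F a in nhds 0. 1 < g a"
    using order_tendstoD(1)[of g "g 0" "at 0" 1] by (simp add: isCont_def eventually_nhds_conv_at)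
  then obtain a0 where a0: "0 < a0" "\<And>a. \<bar>a\<bar> < a0 \<Longrightarrow> 1 < g a"
    unfolding eventually_nhds_metric by (auto simp: dist_real_def)
  \<comment> \<open>Chosen such that \<open>(1 - t) * exp ((c' - c) * a0) = 1\<close>: from order
    \<open>a0\<close> on the first pair suffices alone, and below \<open>a0\<close> both affinities
    are at least 1.\<close>
  define t where "t = 1 - exp (- ((c' - c) * a0))"
  have t: "0 < t" "t < 1" using c a0(1) by (auto simp: t_def)
  have conc: "(1 - t) * affinity a (exp c' *\<^sub>R \<rho>) (exp r *\<^sub>R \<sigma>) + t * g a
    \<le> affinity a (exp c' *\<^sub>R ((1 - t) *\<^sub>R \<rho> + t *\<^sub>R \<rho>0)) (exp r *\<^sub>R ((1 - t) *\<^sub>R \<sigma> + t *\<^sub>R \<sigma>0))"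
    if "a \<in> {0<..<1}" for a
    using affinity_concave[of a "1 - t" t "exp c' *\<^sub>R \<rho>" "exp r *\<^sub>R \<sigma>" "exp c' *\<^sub>R \<rho>0" "exp r *\<^sub>R \<sigma>0"]
      that t st by (simp add: states_nonneg g_def scaleR_add_right mult.commute)
  show thesis
  proof (rule that[OF t])
    fix a :: real assume a: "a \<in> {0<..<1}"
    have e: "exp ((c' - c) * a) \<le> affinity a (exp c' *\<^sub>R \<rho>) (exp r *\<^sub>R \<sigma>)"
      using affinity_exp_mono[OF st(1,2) ge[OF a], of c' r] by simp
    have g_nn: "0 \<le> g a" by (simp add: g_def affinity_nonneg)
    have "1 \<le> (1 - t) * exp ((c' - c) * a) + t * g a"
    proof (cases "a < a0")
      case True
      have "(1 - t) * 1 + t * 1 \<le> (1 - t) * exp ((c' - c) * a) + t * g a"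
        using c a t a0(2)[of a] True by (intro add_mono mult_left_mono) auto
      then show ?thesis by simp
    next
      case False
      then have "1 \<le> exp (- ((c' - c) * a0)) * exp ((c' - c) * a)"
        using c by (simp add: exp_add[symmetric] right_diff_distrib[symmetric])
      moreover have "0 \<le> t * g a" using t g_nn by simp
      ultimately show ?thesis by (simp add: t_def)
    qed
    also have "\<dots> \<le> (1 - t) * affinity a (exp c' *\<^sub>R \<rho>) (exp r *\<^sub>R \<sigma>) + t * g a"
      using e t by simp
    also note conc[OF a]
    finally show "1 \<le> affinity a (exp c' *\<^sub>R ((1 - t) *\<^sub>R \<rho> + t *\<^sub>R \<rho>0))
      (exp r *\<^sub>R ((1 - t) *\<^sub>R \<sigma> + t *\<^sub>R \<sigma>0))" .
  next
    have pos: "\<And>x. 0 \<le> \<rho> $ x" "\<And>x. 0 \<le> \<sigma> $ x" "\<And>x. 0 \<le> \<rho>0 $ x" "\<And>x. 0 \<le> \<sigma>0 $ x"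
      using st by (auto simp: states_nonneg)
    have supp: "supp ((1 - t) *\<^sub>R \<rho> + t *\<^sub>R \<rho>0) = supp \<rho> \<union> supp \<rho>0"
      using pos t by (auto simp: supp_def add_nonneg_eq_0_iff)
    have ge0: "1 \<le> exp r * (\<Sum>x\<in>supp \<rho>. \<sigma> $ x)"
      using affinity_scaled_closed_interval[OF st(1,2) ge, of 0] by (simp add: affinity_0_scaled[OF st(2)])
    have le: "(\<Sum>x\<in>supp \<rho>. \<sigma> $ x) \<le> (\<Sum>x\<in>supp \<rho> \<union> supp \<rho>0. \<sigma> $ x)"
      "(\<Sum>x\<in>supp \<rho>0. \<sigma>0 $ x) \<le> (\<Sum>x\<in>supp \<rho> \<union> supp \<rho>0. \<sigma>0 $ x)"
      using pos by (auto intro!: sum_mono2)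
    have "1 = (1 - t) * 1 + t * 1" by simp
    also have "\<dots> < (1 - t) * (exp r * (\<Sum>x\<in>supp \<rho>. \<sigma> $ x)) + t * (exp r * (\<Sum>x\<in>supp \<rho>0. \<sigma>0 $ x))"
      using ge0 gt t by (intro add_le_less_mono mult_left_mono mult_strict_left_mono) auto
    also have "\<dots> \<le> (1 - t) * (exp r * (\<Sum>x\<in>supp \<rho> \<union> supp \<rho>0. \<sigma> $ x))
        + t * (exp r * (\<Sum>x\<in>supp \<rho> \<union> supp \<rho>0. \<sigma>0 $ x))"
      using le t by (intro add_mono mult_left_mono) auto
    also have "\<dots> = exp r * (\<Sum>x\<in>supp \<rho> \<union> supp \<rho>0. ((1 - t) *\<^sub>R \<sigma> + t *\<^sub>R \<sigma>0) $ x)"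
      unfolding sum_distrib_left sum.distrib[symmetric]
      by (intro sum.cong refl) (simp add: algebra_simps)
    finally show "1 < exp r * (\<Sum>x\<in>supp ((1 - t) *\<^sub>R \<rho> + t *\<^sub>R \<rho>0). ((1 - t) *\<^sub>R \<sigma> + t *\<^sub>R \<sigma>0) $ x)"
      unfolding supp .
  qed
qed

section \<open>The chain of exponents\<close>

lemma compact_states: "compact (states :: (real^'a::finite) set)"
proof -
  have "states = {\<rho> :: real^'a. \<forall>x. 0 \<le> \<rho> $ x} \<inter> {\<rho>. (\<Sum>x\<in>UNIV. \<rho> $ x) = 1}"
    by (auto simp: states_def)
  moreover have "closed {\<rho> :: real^'a. \<forall>x. 0 \<le> \<rho> $ x}"
    by (intro closed_Collect_all closed_Collect_le continuous_intros)
  moreover have "closed {\<rho> :: real^'a. (\<Sum>x\<in>UNIV. \<rho> $ x) = 1}"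
    by (intro closed_Collect_eq continuous_intros)
  ultimately have "closed (states :: (real^'a) set)" by (metis closed_Int)
  moreover have "norm \<rho> \<le> 1" if "\<rho> \<in> states" for \<rho> :: "real^'a"
    using norm_le_l1_cart[of \<rho>] states_nonneg[OF that] states_sum[OF that] by simp
  then have "bounded (states :: (real^'a) set)" unfolding bounded_iff by blast
  ultimately show ?thesis by (simp add: compact_eq_bounded_closed)
qed

lemma convex_states: "convex (states :: (real^'a::finite) set)"
  unfolding convex_def states_def
  by (auto simp: sum.distrib sum_distrib_left[symmetric])

lemma closed_hull_properties:
  fixes R :: "(real^'a::finite) set"
  assumes "R \<subseteq> states" "R \<noteq> {}" and C: "C = closure (convex hull R)"
  shows "compact C" "convex C" "C \<noteq> {}" "C \<subseteq> states" "R \<subseteq> C"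
proof -
  show sub: "C \<subseteq> states"
    unfolding C using assms(1) compact_states convex_states
    by (intro closure_minimal hull_minimal compact_imp_closed)
  show "R \<subseteq> C" unfolding C using hull_subset[of R convex] closure_subset by blast
  then show "C \<noteq> {}" using assms(2) by blast
  show "convex C" unfolding C by (intro convex_closure convex_convex_hull)
  have "closed C" unfolding C by simp
  then show "compact C" using sub compact_states
    by (metis compact_Int_closed inf.absorb_iff2)
qed

text \<open>Every error condition on \<open>HH\<close> carries over to \<open>HH'\<close> with the
  same test. As all tests are quantified, complements give the same for \<open>err1\<close>.
  Positive \<open>n\<close> is required because \<open>adv A 0\<close> is empty for a set of
  densities.\<close>

definition dominated :: "'a::finite hyp set \<Rightarrow> 'a hyp set \<Rightarrow> bool" where
  "dominated HH' HH \<longleftrightarrow> (\<forall>H'\<in>HH'. \<exists>H\<in>HH. \<forall>T n. test_seq T \<longrightarrow> 0 < n \<longrightarrow>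
     0 \<le> err2 H' T n \<and> err2 H' T n \<le> err2 H T n)"

lemma dominatedI:
  assumes "\<And>H'. H' \<in> HH' \<Longrightarrow> \<exists>H\<in>HH. \<forall>n>0. H' n \<noteq> {} \<and> H' n \<subseteq> H n \<and> H n \<subseteq> states_n n"
  shows "dominated HH' HH"
  unfolding dominated_def
proof
  fix H' assume "H' \<in> HH'"
  then obtain H where H: "H \<in> HH" "\<And>n. 0 < n \<Longrightarrow> H' n \<noteq> {} \<and> H' n \<subseteq> H n \<and> H n \<subseteq> states_n n"
    using assms by blast
  have "0 \<le> err2 H' T n \<and> err2 H' T n \<le> err2 H T n" if "test_seq T" "0 < n" for T n
    using err2_nonneg[of T H' n] err2_mono[of T H' n H] H(2)[OF that(2)] that(1) by auto
  then show "\<exists>H\<in>HH. \<forall>T n. test_seq T \<longrightarrow> 0 < n \<longrightarrow> 0 \<le> err2 H' T n \<and> err2 H' T n \<le> err2 H T n"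
    using H(1) by blast
qed

lemma dominated_rate_err2:
  assumes "dominated SS' SS" "test_seq T" "\<forall>S\<in>SS. c \<le> rate (err2 S T)"
  shows "\<forall>S\<in>SS'. c \<le> rate (err2 S T)"
proof
  fix S' assume "S' \<in> SS'"
  then obtain S where "S \<in> SS" "\<And>n. 0 < n \<Longrightarrow> 0 \<le> err2 S' T n \<and> err2 S' T n \<le> err2 S T n"
    using assms(1,2) unfolding dominated_def by blast
  then show "c \<le> rate (err2 S' T)"
    using rate_mono[of "err2 S' T" "err2 S T"] assms(3) order_trans by blast
qed

lemma dominated_rate_err1:
  assumes "dominated RR' RR" "test_seq T" "\<forall>R\<in>RR. c \<le> rate (err1 R T)"
  shows "\<forall>R\<in>RR'. c \<le> rate (err1 R T)"
  using dominated_rate_err2[OF assms(1) test_seq_complement[OF assms(2)]] assms(3)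
  by (simp add: err1_eq)

lemma dominated_err1_tendsto:
  assumes "dominated RR' RR" "test_seq T" "\<forall>R\<in>RR. err1 R T \<longlonglongrightarrow> 0"
  shows "\<forall>R\<in>RR'. err1 R T \<longlonglongrightarrow> 0"
proof
  fix R' assume "R' \<in> RR'"
  then obtain R where R: "R \<in> RR" "\<And>n. 0 < n \<Longrightarrow> 0 \<le> err1 R' T n \<and> err1 R' T n \<le> err1 R T n"
    using assms(1) test_seq_complement[OF assms(2)] unfolding dominated_def err1_eq by blast
  show "err1 R' T \<longlonglongrightarrow> 0"
  proof (rule tendsto_sandwich[OF _ _ tendsto_const])
    show "\<forall>\<^sub>F n in sequentially. 0 \<le> err1 R' T n" "\<forall>\<^sub>F n in sequentially. err1 R' T n \<le> err1 R T n"
      using R(2) by (auto intro!: eventually_sequentiallyI[of 1])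
    show "err1 R T \<longlonglongrightarrow> 0" using assms(3) R(1) by blast
  qed
qed

text \<open>The only property of an exponent behind the links from \<open>e_adv\<close> down to the
  infimum over pairs.\<close>

definition monotone_exponent :: "'a::finite exponent \<Rightarrow> bool" where
  "monotone_exponent e \<longleftrightarrow>
    (\<forall>RR RR' SS SS'. dominated RR' RR \<longrightarrow> dominated SS' SS \<longrightarrow> e RR SS \<le> e RR' SS')"

lemma monotone_stein_exp: "monotone_exponent stein_exp"
  unfolding monotone_exponent_def stein_exp_def
proof (intro allI impI SUP_subset_mono Collect_mono order_refl, elim conjE exE)
  fix RR RR' SS SS' :: "'a hyp set" and r T
  assume d: "dominated RR' RR" "dominated SS' SS" and "0 \<le> r" and T: "test_seq T"
    and rt: "\<forall>S\<in>SS. ereal r \<le> rate (err2 S T)" and lim: "\<forall>R\<in>RR. err1 R T \<longlonglongrightarrow> 0"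
  show "0 \<le> r \<and> (\<exists>T. test_seq T \<and> (\<forall>S\<in>SS'. ereal r \<le> rate (err2 S T)) \<and> (\<forall>R\<in>RR'. err1 R T \<longlonglongrightarrow> 0))"
    using dominated_err1_tendsto[OF d(1) T lim] dominated_rate_err2[OF d(2) T rt] T \<open>0 \<le> r\<close> by blast
qed

lemma monotone_direct_exp: "monotone_exponent (direct_exp r)"
  unfolding monotone_exponent_def direct_exp_def
proof (intro allI impI SUP_subset_mono Collect_mono order_refl, elim conjE exE)
  fix RR RR' SS SS' :: "'a hyp set" and r' T
  assume d: "dominated RR' RR" "dominated SS' SS" and "0 \<le> r'" and T: "test_seq T"
    and rt: "\<forall>S\<in>SS. ereal r \<le> rate (err2 S T)" "\<forall>R\<in>RR. ereal r' \<le> rate (err1 R T)"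
  show "0 \<le> r' \<and> (\<exists>T. test_seq T \<and> (\<forall>S\<in>SS'. ereal r \<le> rate (err2 S T)) \<and> (\<forall>R\<in>RR'. ereal r' \<le> rate (err1 R T)))"
    using dominated_rate_err1[OF d(1) T rt(2)] dominated_rate_err2[OF d(2) T rt(1)] T \<open>0 \<le> r'\<close> by blast
qed

lemma monotone_chernoff_exp: "monotone_exponent chernoff_exp"
  unfolding monotone_exponent_def chernoff_exp_def
proof (intro allI impI SUP_subset_mono Collect_mono order_refl, elim conjE exE)
  fix RR RR' SS SS' :: "'a hyp set" and r T
  assume d: "dominated RR' RR" "dominated SS' SS" and "0 \<le> r" and T: "test_seq T"
    and rt: "\<forall>S\<in>SS. ereal r \<le> rate (err2 S T)" "\<forall>R\<in>RR. ereal r \<le> rate (err1 R T)"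
  show "0 \<le> r \<and> (\<exists>T. test_seq T \<and> (\<forall>S\<in>SS'. ereal r \<le> rate (err2 S T)) \<and> (\<forall>R\<in>RR'. ereal r \<le> rate (err1 R T)))"
    using dominated_rate_err1[OF d(1) T rt(2)] dominated_rate_err2[OF d(2) T rt(1)] T \<open>0 \<le> r\<close> by blast
qed

lemma prod_state_fun_upd:
  assumes "k < n"
  shows "prod_state n (\<rho>(k := v)) xs = v $ (xs ! k) * (\<Prod>i\<in>{..<n} - {k}. \<rho> i $ (xs ! i))"
proof -
  have "prod_state n (\<rho>(k := v)) xs = (\<rho>(k := v)) k $ (xs ! k) * (\<Prod>i\<in>{..<n} - {k}. (\<rho>(k := v)) i $ (xs ! i))"
    unfolding prod_state_def using assms by (intro prod.remove) auto
  also have "(\<Prod>i\<in>{..<n} - {k}. (\<rho>(k := v)) i $ (xs ! i)) = (\<Prod>i\<in>{..<n} - {k}. \<rho> i $ (xs ! i))"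
    by (intro prod.cong) auto
  finally show ?thesis by (simp only: fun_upd_same)
qed

text \<open>An expectation is affine in each factor of a product density, so that the factors can be moved
  from \<open>R\<close> into its closed convex hull one after the other.\<close>

lemma expect_av_closed_hull_le:
  fixes R :: "(real^'a::finite) set"
  assumes bd: "\<And>\<omega>. \<omega> \<in> av R n \<Longrightarrow> expect n \<omega> f \<le> M" and "\<omega> \<in> av (closure (convex hull R)) n"
  shows "expect n \<omega> f \<le> M"
proof -
  \<comment> \<open>The first \<open>k\<close> factors have already been moved to the hull; the
    induction moves the next one.\<close>
  have "\<forall>\<rho>. (\<forall>i<k. \<rho> i \<in> closure (convex hull R)) \<and> (\<forall>i. k \<le> i \<and> i < n \<longrightarrow> \<rho> i \<in> R)
      \<longrightarrow> expect n (prod_state n \<rho>) f \<le> M" if "k \<le> n" for k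
    using that
  proof (induction k)
    case 0
    then show ?case using bd by (auto simp: av_def)
  next
    case (Suc k)
    show ?case
    proof (intro allI impI)
      fix \<rho> :: "nat \<Rightarrow> real^'a"
      assume \<rho>: "(\<forall>i<Suc k. \<rho> i \<in> closure (convex hull R)) \<and> (\<forall>i. Suc k \<le> i \<and> i < n \<longrightarrow> \<rho> i \<in> R)"
      define L where "L v = (\<Sum>xs\<in>seqs n. v $ (xs ! k) * ((\<Prod>i\<in>{..<n} - {k}. \<rho> i $ (xs ! i)) * f xs))" for v
      have L: "expect n (prod_state n (\<rho>(k := v))) f = L v" for v
        using Suc.prems by (simp add: expect_def L_def prod_state_fun_upd mult.assoc)
      have "closed {v. L v \<le> M}"
        unfolding L_def by (intro closed_Collect_le continuous_intros)
      moreover have "convex {v. L v \<le> M}"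
      proof (rule convexI, clarsimp)
        fix v w :: "real^'a" and s t :: real
        assume vw: "L v \<le> M" "L w \<le> M" and st: "0 \<le> s" "0 \<le> t" "s + t = 1"
        have "L (s *\<^sub>R v + t *\<^sub>R w) = s * L v + t * L w"
          by (simp add: L_def distrib_right sum.distrib sum_distrib_left mult.assoc)
        also have "\<dots> \<le> M" using convex_bound_le[OF vw st] .
        finally show "L (s *\<^sub>R v + t *\<^sub>R w) \<le> M" .
      qed
      moreover have "L v \<le> M" if "v \<in> R" for v
      proof -
        have "(\<forall>i<k. (\<rho>(k := v)) i \<in> closure (convex hull R)) \<and>
            (\<forall>i. k \<le> i \<and> i < n \<longrightarrow> (\<rho>(k := v)) i \<in> R)"
          using \<rho> that by (auto simp: less_Suc_eq)
        then have "expect n (prod_state n (\<rho>(k := v))) f \<le> M"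
          by (rule Suc.IH[THEN spec, THEN mp, OF Suc_leD[OF Suc.prems]])
        then show ?thesis by (simp only: L)
      qed
      ultimately have "closure (convex hull R) \<subseteq> {v. L v \<le> M}"
        by (intro closure_minimal hull_minimal) auto
      then show "expect n (prod_state n \<rho>) f \<le> M"
        using \<rho> L[of "\<rho> k"] by (auto simp: subset_iff)
    qed
  qed
  from this[of n] show ?thesis using assms(2) by (auto simp: av_def)
qed

section \<open>Lower bounds for the adversarial exponents\<close>

lemma ereal_le_if_reals_le:
  fixes u v :: ereal
  assumes "\<And>x. ereal x < u \<Longrightarrow> ereal x \<le> v"
  shows "u \<le> v"
proof (rule ccontr)
  assume "\<not> u \<le> v"
  then have "v < u" by simp
  then obtain x where "v < ereal x" "ereal x < u" using ereal_dense2 by blast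
  then show False using assms[of x] by simp
qed

lemma less_set_divD:
  assumes "c < set_div E A B" "\<rho> \<in> A" "\<sigma> \<in> B"
  shows "c < E \<rho> \<sigma>"
proof -
  have "set_div E A B \<le> E \<rho> \<sigma>"
    unfolding set_div_def using assms(2,3) by (meson INF_lower2 INF_lower order_refl)
  then show ?thesis using assms(1) by simp
qed

lemma adv_nonempty: "A \<noteq> {} \<Longrightarrow> A \<subseteq> states \<Longrightarrow> 0 < n \<Longrightarrow> adv A n \<noteq> {}"
  using iid_nonempty[of A n] iid_subset_av[of A n] av_subset_adv[of A n] by blast

lemma err2_adv_bounds:
  assumes "A \<noteq> {}" "A \<subseteq> states" "0 < n" "test_seq T"
  shows "0 \<le> err2 (adv A) T n" "err2 (adv A) T n \<le> 1"
  using err2_nonneg[where R = "adv A" and n = n,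
      OF assms(4) adv_subset_states_n adv_nonempty[OF assms(1-3)]]
    err2_le[where R = "adv A" and n = n, OF adv_nonempty[OF assms(1-3)], of T 1]
    expect_test_bounds(2)[OF assms(4)] adv_subset_states_n[of A n] by blast+

text \<open>A supremum over an empty set would be \<open>-\<infinity>\<close>. Constant tests rule
  this out: always accepting for Stein, never accepting for the other two, where the second error is
  0 and hence has infinite rate.\<close>

lemma adv_exponents_nonneg:
  fixes A B :: "(real^'a::finite) set"
  assumes A: "A \<noteq> {}" "A \<subseteq> states" and B: "B \<noteq> {}" "B \<subseteq> states"
  shows "0 \<le> e_adv stein_exp A B" "0 \<le> e_adv chernoff_exp A B" "0 \<le> e_adv (direct_exp r) A B"
proof -
  have ge0: "ereal 0 \<le> rate (err2 (adv C) T)" if "C \<noteq> {}" "C \<subseteq> states" "test_seq T" for C :: "(real^'a) set" and T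
    by (rule rate_ge) (use err2_adv_bounds[OF that(1,2) _ that(3)] in auto)
  have zero: "err2 (adv C) (\<lambda>_ _. 0) n = 0" if "C \<noteq> {}" "C \<subseteq> states" "0 < n" for C :: "(real^'a) set" and n
    using adv_nonempty[OF that] by (simp add: err2_def expect_def)
  have T0: "test_seq (\<lambda>_ _. 0)" and T1: "test_seq (\<lambda>_ _. 1)" by (auto simp: test_seq_def)
  have "err1 (adv A) (\<lambda>_ _. 1) \<longlonglongrightarrow> 0"
    by (rule tendsto_eventually)
       (use zero[OF A] in \<open>auto simp: err1_eq intro!: eventually_sequentiallyI[of 1]\<close>)
  then show "0 \<le> e_adv stein_exp A B"
    unfolding e_adv_def stein_exp_def zero_ereal_def
    by (intro SUP_upper2[of 0]) (use T1 ge0[OF B T1] in auto)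
  have c: "ereal 0 \<le> rate (err1 (adv A) (\<lambda>_ _. 0))"
    unfolding err1_eq by (rule ge0[OF A test_seq_complement[OF T0]])
  then show "0 \<le> e_adv chernoff_exp A B"
    unfolding e_adv_def chernoff_exp_def zero_ereal_def
    by (intro SUP_upper2[of 0]) (use T0 ge0[OF B T0] in auto)
  have "ereal r \<le> rate (err2 (adv B) (\<lambda>_ _. 0))"
    by (rule rate_ge) (auto simp: zero[OF B])
  then show "0 \<le> e_adv (direct_exp r) A B"
    unfolding e_adv_def direct_exp_def zero_ereal_def
    by (intro SUP_upper2[of 0]) (use T0 c in auto)
qed

text \<open>For \<open>c = 0\<close> the rate alone would not force the first error to 0; the
  remaining factor \<open>q < 1\<close> does.\<close>

lemma adv_rates:
  fixes A B :: "(real^'a::finite) set"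
  assumes A: "compact A" "convex A" "A \<noteq> {}" "A \<subseteq> states"
    and B: "compact B" "convex B" "B \<noteq> {}" "B \<subseteq> states"
    and lt: "\<And>\<rho> \<sigma>. \<rho> \<in> A \<Longrightarrow> \<sigma> \<in> B \<Longrightarrow>
      \<exists>a\<in>{0<..<1}. affinity a (exp c *\<^sub>R \<rho>) (exp r *\<^sub>R \<sigma>) < 1"
  obtains T where "test_seq T" "ereal c \<le> rate (err1 (adv A) T)" "ereal r \<le> rate (err2 (adv B) T)"
    "c = 0 \<Longrightarrow> err1 (adv A) T \<longlonglongrightarrow> 0"
proof -
  obtain T q where T: "test_seq T" and q: "0 \<le> q" "q < 1"
    and e1: "\<And>n. 0 < n \<Longrightarrow> err1 (adv A) T n \<le> (exp (- c) * q) ^ n"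
    and e2: "\<And>n. 0 < n \<Longrightarrow> err2 (adv B) T n \<le> (exp (- r) * q) ^ n"
    by (rule adv_tests[OF A B lt]) (assumption | rule that)+
  have nn: "0 \<le> err1 (adv A) T n" "0 \<le> err2 (adv B) T n" if "0 < n" for n
    unfolding err1_eq
    using err2_adv_bounds(1)[OF A(3,4) that test_seq_complement[OF T]]
      err2_adv_bounds(1)[OF B(3,4) that T] .
  have le: "(exp s * q) ^ n \<le> exp s ^ n" for s n
    using q by (intro power_mono) (auto simp: mult_left_le)
  show thesis
  proof (rule that[OF T])
    show "ereal c \<le> rate (err1 (adv A) T)" by (rule rate_ge[OF nn(1) order_trans[OF e1 le]])
    show "ereal r \<le> rate (err2 (adv B) T)" by (rule rate_ge[OF nn(2) order_trans[OF e2 le]])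
    show "err1 (adv A) T \<longlonglongrightarrow> 0" if "c = 0"
    proof (rule tendsto_sandwich[OF _ _ tendsto_const])
      show "\<forall>\<^sub>F n in sequentially. 0 \<le> err1 (adv A) T n" "\<forall>\<^sub>F n in sequentially. err1 (adv A) T n \<le> q ^ n"
        using nn(1) e1 that by (auto intro!: eventually_sequentiallyI[of 1])
      show "(\<lambda>n. q ^ n) \<longlonglongrightarrow> 0" using q by (intro LIMSEQ_power_zero) simp
    qed
  qed
qed

text \<open>A real \<open>x\<close> below the divergence of the sets is below that of every pair.
  The rates \<open>(c, r)\<close> are then \<open>(0, x)\<close>, \<open>(x, x)\<close> and
  \<open>(x, r)\<close>. Negative \<open>x\<close> is treated apart because the exponents admit only
  nonnegative rates.\<close>

lemma set_div_le_adv: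
  fixes A B :: "(real^'a::finite) set"
  assumes A: "compact A" "convex A" "A \<noteq> {}" "A \<subseteq> states"
    and B: "compact B" "convex B" "B \<noteq> {}" "B \<subseteq> states"
  shows "set_div relative_entropy A B \<le> e_adv stein_exp A B"
    and "set_div chernoff_div A B \<le> e_adv chernoff_exp A B"
    and "set_div (hoeffding_div r) A B \<le> e_adv (direct_exp r) A B"
proof -
  note nonneg = adv_exponents_nonneg[OF A(3,4) B(3,4)]
  have neg: "ereal x \<le> v" if "x < 0" "0 \<le> v" for x v
    by (rule order_trans[of "ereal x" 0]) (use that in auto)
  show "set_div relative_entropy A B \<le> e_adv stein_exp A B"
  proof (rule ereal_le_if_reals_le)
    fix x assume x: "ereal x < set_div relative_entropy A B"
    show "ereal x \<le> e_adv stein_exp A B"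
    proof (cases "x < 0")
      case False
      have lt: "\<exists>a\<in>{0<..<1}. affinity a (exp 0 *\<^sub>R \<rho>) (exp x *\<^sub>R \<sigma>) < 1"
        if "\<rho> \<in> A" "\<sigma> \<in> B" for \<rho> \<sigma>
        by (rule less_relative_entropy_imp_affinity[OF _ _ less_set_divD[OF x that]]) (use that A(4) B(4) in auto)
      obtain T where "test_seq T" "ereal 0 \<le> rate (err1 (adv A) T)" "ereal x \<le> rate (err2 (adv B) T)"
        "(0::real) = 0 \<Longrightarrow> err1 (adv A) T \<longlonglongrightarrow> 0"
        by (rule adv_rates[OF A B lt]) (assumption | rule that)+
      then show ?thesis
        unfolding e_adv_def stein_exp_def using False by (intro SUP_upper CollectI conjI exI[of _ T]) auto
    qed (rule neg[OF _ nonneg(1)])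
  qed
  show "set_div chernoff_div A B \<le> e_adv chernoff_exp A B"
  proof (rule ereal_le_if_reals_le)
    fix x assume x: "ereal x < set_div chernoff_div A B"
    show "ereal x \<le> e_adv chernoff_exp A B"
    proof (cases "x < 0")
      case False
      have lt: "\<exists>a\<in>{0<..<1}. affinity a (exp x *\<^sub>R \<rho>) (exp x *\<^sub>R \<sigma>) < 1"
        if "\<rho> \<in> A" "\<sigma> \<in> B" for \<rho> \<sigma>
        by (rule less_chernoff_div_iff[THEN iffD1, OF _ _ less_set_divD[OF x that]]) (use that A(4) B(4) in auto)
      obtain T where "test_seq T" "ereal x \<le> rate (err1 (adv A) T)" "ereal x \<le> rate (err2 (adv B) T)"
        by (rule adv_rates[OF A B lt]) (assumption | rule that)+
      then show ?thesis
        unfolding e_adv_def chernoff_exp_def using False by (intro SUP_upper CollectI conjI exI[of _ T]) auto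
    qed (rule neg[OF _ nonneg(2)])
  qed
  show "set_div (hoeffding_div r) A B \<le> e_adv (direct_exp r) A B"
  proof (rule ereal_le_if_reals_le)
    fix x assume x: "ereal x < set_div (hoeffding_div r) A B"
    show "ereal x \<le> e_adv (direct_exp r) A B"
    proof (cases "x < 0")
      case False
      have lt: "\<exists>a\<in>{0<..<1}. affinity a (exp x *\<^sub>R \<rho>) (exp r *\<^sub>R \<sigma>) < 1"
        if "\<rho> \<in> A" "\<sigma> \<in> B" for \<rho> \<sigma>
        by (rule less_hoeffding_div_iff[THEN iffD1, OF _ _ less_set_divD[OF x that]]) (use that A(4) B(4) in auto)
      obtain T where "test_seq T" "ereal x \<le> rate (err1 (adv A) T)" "ereal r \<le> rate (err2 (adv B) T)"
        by (rule adv_rates[OF A B lt]) (assumption | rule that)+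
      then show ?thesis
        unfolding e_adv_def direct_exp_def using False by (intro SUP_upper CollectI conjI exI[of _ T]) auto
    qed (rule neg[OF _ nonneg(3)])
  qed
qed

lemma INF_simple_le_set_div:
  assumes "\<And>\<rho> \<sigma>. \<rho> \<in> A \<Longrightarrow> \<sigma> \<in> B \<Longrightarrow> (INF \<rho>\<in>A. INF \<sigma>\<in>B. f \<rho> \<sigma>) \<le> E \<rho> \<sigma>"
  shows "(INF \<rho>\<in>A. INF \<sigma>\<in>B. f \<rho> \<sigma>) \<le> set_div E A B"
  unfolding set_div_def using assms by (intro INF_greatest)

lemma INF2_lower: "\<rho> \<in> A \<Longrightarrow> \<sigma> \<in> B \<Longrightarrow> (INF \<rho>\<in>A. INF \<sigma>\<in>B. f \<rho> \<sigma>) \<le> (f \<rho> \<sigma> :: ereal)"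
  by (meson INF_lower2 INF_lower order_refl)

text \<open>A pair with \<open>r = renyi_div_0 \<rho> \<sigma>\<close> is approximated by mixing in a pair with
  \<open>renyi_div_0 < r\<close>, which exists unless \<open>r\<close> is the minimal value.\<close>

lemma INF_direct_exp_le_hoeffding:
  fixes A B :: "(real^'a::finite) set"
  assumes A: "convex A" "A \<subseteq> states" and B: "convex B" "B \<subseteq> states"
    and ne: "ereal r \<noteq> set_div renyi_div_0 A B" and mem: "\<rho> \<in> A" "\<sigma> \<in> B"
  shows "(INF \<rho>\<in>A. INF \<sigma>\<in>B. e_simple (direct_exp r) \<rho> \<sigma>) \<le> hoeffding_div r \<rho> \<sigma>"
    (is "?V \<le> _")
proof -
  have st: "\<rho> \<in> states" if "\<rho> \<in> A \<union> B" for \<rho> using that A(2) B(2) by auto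
  have le: "?V \<le> hoeffding_div r \<rho> \<sigma>" if "\<rho> \<in> A" "\<sigma> \<in> B" "ereal r \<noteq> renyi_div_0 \<rho> \<sigma>" for \<rho> \<sigma>
    by (rule order_trans[OF INF2_lower[where f = "e_simple (direct_exp r)", OF that(1,2)]
          direct_exp_simple_le[OF _ _ that(3)]])
       (use st that in auto)
  show ?thesis
  proof (cases "ereal r = renyi_div_0 \<rho> \<sigma>")
    case True
    have "set_div renyi_div_0 A B \<le> ereal r"
      unfolding True set_div_def using mem by (rule INF2_lower)
    then have "set_div renyi_div_0 A B < ereal r" using ne by simp
    then obtain \<rho>0 \<sigma>0 where mem0: "\<rho>0 \<in> A" "\<sigma>0 \<in> B" and "renyi_div_0 \<rho>0 \<sigma>0 < ereal r"
      unfolding set_div_def by (auto simp: INF_less_iff)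
    then have gt: "1 < exp r * (\<Sum>x\<in>supp \<rho>0. \<sigma>0 $ x)"
      using ereal_le_renyi_div_0_iff[of \<sigma>0 r \<rho>0] st by (auto simp: not_le[symmetric])
    show ?thesis
    proof (rule ccontr)
      assume "\<not> ?thesis"
      then have "hoeffding_div r \<rho> \<sigma> < ?V" by simp
      \<comment> \<open>Two intermediate values: \<open>c' < ?V\<close> is to be contradicted by the
        mixed pair, and the gap between \<open>c\<close> and \<open>c'\<close> is what mixing
        consumes.\<close>
      then obtain c' where c': "hoeffding_div r \<rho> \<sigma> < ereal c'" "ereal c' < ?V"
        using ereal_dense2 by blast
      then obtain c where c: "hoeffding_div r \<rho> \<sigma> < ereal c" "c < c'"
        using ereal_dense2[OF c'(1)] by auto
      have ge: "1 \<le> affinity a (exp c *\<^sub>R \<rho>) (exp r *\<^sub>R \<sigma>)" if "a \<in> {0<..<1}" for a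
        using less_hoeffding_div_iff[of \<rho> \<sigma> c r] st mem c(1) that by (auto simp: not_less[symmetric])
      obtain t where t: "0 < t" "t < 1"
        and ge': "\<And>a. a \<in> {0<..<1} \<Longrightarrow> 1 \<le> affinity a (exp c' *\<^sub>R ((1 - t) *\<^sub>R \<rho> + t *\<^sub>R \<rho>0))
          (exp r *\<^sub>R ((1 - t) *\<^sub>R \<sigma> + t *\<^sub>R \<sigma>0))"
        and gt': "1 < exp r * (\<Sum>x\<in>supp ((1 - t) *\<^sub>R \<rho> + t *\<^sub>R \<rho>0). ((1 - t) *\<^sub>R \<sigma> + t *\<^sub>R \<sigma>0) $ x)"
        by (rule mix_pairs[OF _ _ _ _ c(2) ge gt]) (use st mem mem0 in auto)
      define \<rho>t where "\<rho>t = (1 - t) *\<^sub>R \<rho> + t *\<^sub>R \<rho>0"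
      define \<sigma>t where "\<sigma>t = (1 - t) *\<^sub>R \<sigma> + t *\<^sub>R \<sigma>0"
      have memt: "\<rho>t \<in> A" "\<sigma>t \<in> B"
        unfolding \<rho>t_def \<sigma>t_def
        using convexD[OF A(1) mem(1) mem0(1), of "1 - t" t] convexD[OF B(1) mem(2) mem0(2), of "1 - t" t] t
        by auto
      then have stt: "\<rho>t \<in> states" "\<sigma>t \<in> states" using st by auto
      have "ereal r \<noteq> renyi_div_0 \<rho>t \<sigma>t"
        using gt' ereal_eq_renyi_div_0_iff[OF stt(2)] by (simp add: \<rho>t_def \<sigma>t_def)
      then have "?V \<le> hoeffding_div r \<rho>t \<sigma>t" using le memt by blast
      then have "ereal c' < hoeffding_div r \<rho>t \<sigma>t" using c'(2) by simp
      then show False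
        using ge' unfolding less_hoeffding_div_iff[OF stt] \<rho>t_def[symmetric] \<sigma>t_def[symmetric]
        by (auto simp: not_less[symmetric])
    qed
  qed (use le mem in blast)
qed

text \<open>The midpoint of two densities is supported on the union of their supports, so a support
  of maximal size contains all others.\<close>

lemma exists_maximal_support:
  fixes A :: "(real^'a::finite) set"
  assumes "convex A" "A \<noteq> {}" "A \<subseteq> states"
  obtains \<rho> where "\<rho> \<in> A" "\<And>\<rho>'. \<rho>' \<in> A \<Longrightarrow> supp \<rho>' \<subseteq> supp \<rho>"
proof -
  have "finite ((\<lambda>\<rho>. card (supp \<rho>)) ` A)"
    by (rule finite_subset[of _ "{..CARD('a)}"]) (auto intro: card_mono)
  note fin = this
  have "Max ((\<lambda>\<rho>. card (supp \<rho>)) ` A) \<in> (\<lambda>\<rho>. card (supp \<rho>)) ` A"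
    using fin assms(2) by (intro Max_in) auto
  then obtain \<rho> where \<rho>1: "\<rho> \<in> A" "Max ((\<lambda>\<rho>. card (supp \<rho>)) ` A) = card (supp \<rho>)" by auto
  have \<rho>: "\<rho> \<in> A" "\<And>\<rho>'. \<rho>' \<in> A \<Longrightarrow> card (supp \<rho>') \<le> card (supp \<rho>)"
    using \<rho>1 Max_ge[OF fin] by force+
  have "supp \<rho>' \<subseteq> supp \<rho>" if "\<rho>' \<in> A" for \<rho>'
  proof -
    define \<tau> where "\<tau> = (1 / 2) *\<^sub>R \<rho> + (1 / 2) *\<^sub>R \<rho>'"
    have "\<tau> \<in> A" unfolding \<tau>_def using convexD[OF assms(1) \<rho>(1) that] by simp
    moreover have "supp \<tau> = supp \<rho> \<union> supp \<rho>'"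
      using states_nonneg[of \<rho>] states_nonneg[of \<rho>'] \<rho>(1) that assms(3)
      by (auto simp: \<tau>_def supp_def subset_iff add_nonneg_eq_0_iff)
    ultimately have "card (supp \<rho> \<union> supp \<rho>') \<le> card (supp \<rho>)" using \<rho>(2) by metis
    then have "supp \<rho> = supp \<rho> \<union> supp \<rho>'" by (intro card_seteq) auto
    then show ?thesis by blast
  qed
  then show thesis using \<rho>(1) that by blast
qed

text \<open>The test that accepts \<open>A\<close> iff all samples are in the largest support of a density in \<open>A\<close>.\<close>

lemma direct_exp_adv_exceptional:
  fixes A B :: "(real^'a::finite) set"
  assumes A: "convex A" "A \<noteq> {}" "A \<subseteq> states" and B: "B \<noteq> {}" "B \<subseteq> states"
    and r: "ereal r \<le> set_div renyi_div_0 A B"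
  shows "e_adv (direct_exp r) A B = \<infinity>"
proof -
  obtain \<rho>0 where \<rho>0: "\<rho>0 \<in> A" "\<And>\<rho>. \<rho> \<in> A \<Longrightarrow> supp \<rho> \<subseteq> supp \<rho>0"
    using exists_maximal_support[OF A] by blast
  define T where "T n xs = (if set xs \<subseteq> supp \<rho>0 then 1 else 0 :: real)" for n :: nat and xs :: "'a list"
  have T: "test_seq T" by (auto simp: test_seq_def T_def)
  have err2: "err2 (adv B) T n \<le> exp (- r) ^ n" if "0 < n" for n
  proof (rule err2_le[where R = "adv B" and n = n, OF adv_nonempty[OF B that]])
    fix \<omega> assume \<omega>: "\<omega> \<in> adv B n"
    \<comment> \<open>The test is a product of indicators, whose means over \<open>B\<close> are the
      masses on the largest support; these are at most \<open>exp (- r)\<close> by the assumption on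
      \<open>r\<close>.\<close>
    define g where "g x = (if x \<in> supp \<rho>0 then 1 else 0 :: real)" for x
    have "T n xs \<le> prod_list (map g xs)" for xs
    proof -
      have "0 \<le> prod_list (map g xs)" by (rule prod_list_map_nonneg) (simp add: g_def)
      moreover have "prod_list (map g xs) = 1" if "set xs \<subseteq> supp \<rho>0"
        using that by (induction xs) (auto simp: g_def)
      ultimately show ?thesis by (simp add: T_def)
    qed
    then have "expect n \<omega> (T n) \<le> expect n \<omega> (\<lambda>xs. prod_list (map g xs))"
      by (rule adv_expect_mono[OF \<omega>])
    also have "\<dots> \<le> exp (- r) ^ n"
    proof (rule adv_expect_prod_list_le[OF \<omega> that])
      fix \<sigma> assume "\<sigma> \<in> B"
      have "set_div renyi_div_0 A B \<le> renyi_div_0 \<rho>0 \<sigma>"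
        unfolding set_div_def using \<rho>0(1) \<open>\<sigma> \<in> B\<close> by (rule INF2_lower)
      then have "exp r * (\<Sum>x\<in>supp \<rho>0. \<sigma> $ x) \<le> 1"
        using ereal_le_renyi_div_0_iff[of \<sigma> r \<rho>0] r \<open>\<sigma> \<in> B\<close> B(2) by (meson order_trans subsetD)
      moreover have "(\<Sum>x\<in>UNIV. \<sigma> $ x * g x) = (\<Sum>x\<in>supp \<rho>0. \<sigma> $ x)"
      proof -
        have "(\<Sum>x\<in>UNIV. \<sigma> $ x * g x) = (\<Sum>x\<in>UNIV. if x \<in> supp \<rho>0 then \<sigma> $ x else 0)"
          by (intro sum.cong) (auto simp: g_def)
        then show ?thesis by (simp add: sum.If_cases)
      qed
      ultimately show "(\<Sum>x\<in>UNIV. \<sigma> $ x * g x) \<le> exp (- r)" by (simp add: exp_minus field_simps)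
    qed (auto simp: g_def)
    finally show "expect n \<omega> (T n) \<le> exp (- r) ^ n" .
  qed
  \<comment> \<open>As \<open>c\<close> is arbitrary, the error is in fact 0; this form is what the
    mean bound for adversarial densities delivers.\<close>
  have err1: "err1 (adv A) T n \<le> exp (- c) ^ n" if "0 < n" "0 \<le> c" for n c
    unfolding err1_eq
  proof (rule err2_le[where R = "adv A" and n = n, OF adv_nonempty[OF A(2,3) that(1)]])
    fix \<omega> assume \<omega>: "\<omega> \<in> adv A n"
    \<comment> \<open>A large weight on letters outside the support does not change the means over \<open>A\<close>.\<close>
    define K where "K = exp (c * n)"
    have K: "1 \<le> K" using that by (simp add: K_def)
    define g where "g x = (if x \<in> supp \<rho>0 then 1 else K)" for x
    have g1: "1 \<le> g x" for x using K by (simp add: g_def)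
    have prod1: "1 \<le> prod_list (map g xs)" for xs
      by (induction xs) (use g1 in \<open>auto intro: mult_ge1_I\<close>)
    have "K \<le> prod_list (map g xs)" if "\<not> set xs \<subseteq> supp \<rho>0" for xs
      using that
    proof (induction xs)
      case (Cons x xs)
      show ?case
      proof (cases "x \<in> supp \<rho>0")
        case True
        then show ?thesis using Cons by (simp add: g_def)
      next
        case False
        have "K * 1 \<le> K * prod_list (map g xs)" using prod1 K by (intro mult_left_mono) auto
        then show ?thesis using False by (simp add: g_def[of x])
      qed
    qed simp
    then have "K * (1 - T n xs) \<le> prod_list (map g xs)" for xs
      using prod1[of xs] by (auto simp: T_def)
    then have "expect n \<omega> (\<lambda>xs. K * (1 - T n xs)) \<le> expect n \<omega> (\<lambda>xs. prod_list (map g xs))"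
      by (rule adv_expect_mono[OF \<omega>])
    also have "\<dots> \<le> 1 ^ n"
    proof (rule adv_expect_prod_list_le[OF \<omega> that(1)])
      fix \<rho> assume "\<rho> \<in> A"
      have "\<rho> $ x * g x = \<rho> $ x" for x
        using \<rho>0(2)[OF \<open>\<rho> \<in> A\<close>] by (auto simp: g_def supp_def)
      then have "(\<Sum>x\<in>UNIV. \<rho> $ x * g x) = (\<Sum>x\<in>UNIV. \<rho> $ x)"
        by (intro sum.cong refl)
      then show "(\<Sum>x\<in>UNIV. \<rho> $ x * g x) \<le> 1"
        using states_sum[of \<rho>] \<open>\<rho> \<in> A\<close> A(3) by auto
    qed (use K in \<open>auto simp: g_def\<close>)
    finally have "K * expect n \<omega> (\<lambda>xs. 1 - T n xs) \<le> 1"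
      by (simp add: expect_def sum_distrib_left mult.left_commute)
    then have "expect n \<omega> (\<lambda>xs. 1 - T n xs) \<le> exp (- (c * n))"
      by (simp add: K_def exp_minus field_simps)
    then show "expect n \<omega> (\<lambda>xs. 1 - T n xs) \<le> exp (- c) ^ n"
      by (simp add: exp_of_nat_mult[symmetric] mult.commute)
  qed
  have "ereal c \<le> e_adv (direct_exp r) A B" if "0 \<le> c" for c
    unfolding e_adv_def direct_exp_def
  proof (rule SUP_upper, clarsimp, intro conjI exI[of _ T])
    show "ereal r \<le> rate (err2 (adv B) T)"
      by (rule rate_ge) (use err2 err2_adv_bounds(1)[OF B _ T] in auto)
    show "ereal c \<le> rate (err1 (adv A) T)"
      by (rule rate_ge)
         (use err1 that err2_adv_bounds(1)[OF A(2,3) _ test_seq_complement[OF T]] in \<open>auto simp: err1_eq\<close>)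
  qed fact+
  then have "ereal c \<le> e_adv (direct_exp r) A B" for c
    by (rule order_trans[rotated, of "ereal (max c 0)"]) auto
  then show ?thesis by (rule ereal_top)
qed

text \<open>Each inequality is monotonicity along an inclusion of hypotheses or a passage to single
  densities.\<close>

lemma exponent_chain:
  fixes R S coR coS :: "(real^'a::finite) set"
  assumes R: "R \<subseteq> states" "R \<noteq> {}" and S: "S \<subseteq> states" "S \<noteq> {}"
    and coR: "coR = closure (convex hull R)" and coS: "coS = closure (convex hull S)"
    and e: "monotone_exponent e"
  shows "e_adv e coR coS \<le> e_adv e R S" "e_adv e R S \<le> e_av e R S"
    "e_av e R S = e_av e coR coS" "e_av e coR coS \<le> e_iid e coR coS"
    "x \<in> {0, 1} \<Longrightarrow> e_iid e coR coS \<le> e_relaxed {x} e coR coS"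
    "x \<in> {0, 1} \<Longrightarrow> e_relaxed {x} e coR coS \<le> e_relaxed {0, 1} e coR coS"
    "e_relaxed {0, 1} e coR coS \<le> (INF \<rho>\<in>coR. INF \<sigma>\<in>coS. e_simple e \<rho> \<sigma>)"
proof -
  note cR = closed_hull_properties[OF R coR] and cS = closed_hull_properties[OF S coS]
  have mono: "e RR SS \<le> e RR' SS'" if "dominated RR' RR" "dominated SS' SS" for RR RR' SS SS'
    using e that unfolding monotone_exponent_def by blast
  have av_states: "av A n \<subseteq> states_n n" if "A \<subseteq> states" "0 < n" for A :: "(real^'a) set" and n
    using av_subset_adv[OF that] adv_subset_states_n by blast
  have iid_states: "iid A n \<subseteq> states_n n" if "A \<subseteq> states" "0 < n" for A :: "(real^'a) set" and n
    using av_states[OF that] iid_subset_av by blast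
  have av_nonempty: "av A n \<noteq> {}" if "A \<noteq> {}" for A :: "(real^'a) set" and n
    using iid_nonempty[OF that] iid_subset_av by blast
  have d_adv: "dominated {adv A} {adv B}" if "A \<subseteq> B" "B \<subseteq> states" "A \<noteq> {}" for A B :: "(real^'a) set"
    by (rule dominatedI) (use that adv_nonempty[of A] adv_mono[of A B] adv_subset_states_n[of B] in auto)
  have d_av_adv: "dominated {av A} {adv A}" if "A \<subseteq> states" "A \<noteq> {}" for A :: "(real^'a) set"
    by (rule dominatedI) (use that av_nonempty[of A] av_subset_adv[of A] adv_subset_states_n[of A] in auto)
  have d_av: "dominated {av A} {av B}" if "A \<subseteq> B" "B \<subseteq> states" "A \<noteq> {}" for A B :: "(real^'a) set"
    by (rule dominatedI) (use that av_nonempty[of A] av_mono[of A B] av_states[of B] in auto)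
  have d_iid_av: "dominated {iid A} {av A}" if "A \<subseteq> states" "A \<noteq> {}" for A :: "(real^'a) set"
    by (rule dominatedI) (use that iid_nonempty[of A] iid_subset_av[of A] av_states[of A] in auto)
  have d_iid: "dominated {iid A} {iid A}" if "A \<subseteq> states" "A \<noteq> {}" for A :: "(real^'a) set"
    by (rule dominatedI) (use that iid_nonempty[of A] iid_states[of A] in auto)
  have d_single: "dominated {iid {\<rho>} | \<rho>. \<rho> \<in> A} {iid A}" if "A \<subseteq> states" for A :: "(real^'a) set"
    by (rule dominatedI) (use that iid_states[of A] in \<open>auto simp: iid_def\<close>)
  have d_singles: "dominated {iid {\<rho>} | \<rho>. \<rho> \<in> A} {iid {\<rho>} | \<rho>. \<rho> \<in> A}"
    if "A \<subseteq> states" for A :: "(real^'a) set"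
  proof (rule dominatedI)
    fix H assume H: "H \<in> {iid {\<rho>} | \<rho>. \<rho> \<in> A}"
    then obtain \<rho> where "H = iid {\<rho>}" "\<rho> \<in> A" by blast
    then have "\<forall>n>0. H n \<noteq> {} \<and> H n \<subseteq> H n \<and> H n \<subseteq> states_n n"
      using that iid_states[of "{\<rho>}"] iid_nonempty[of "{\<rho>}"] by auto
    then show "\<exists>H'\<in>{iid {\<rho>} | \<rho>. \<rho> \<in> A}. \<forall>n>0. H n \<noteq> {} \<and> H n \<subseteq> H' n \<and> H' n \<subseteq> states_n n"
      using H by blast
  qed
  have d_pick: "dominated {iid {\<rho>}} {iid {\<rho>} | \<rho>. \<rho> \<in> A}" if "A \<subseteq> states" "\<rho> \<in> A" for A and \<rho> :: "real^'a"
    using d_singles[OF that(1)] d_iid[of "{\<rho>}"] that unfolding dominated_def by blast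
  \<comment> \<open>The one comparison against an inclusion: the hull gives more product densities,
    but by affinity in each factor no larger error.\<close>
  have d_hull: "dominated {av (closure (convex hull A))} {av A}"
    if "A \<subseteq> states" "A \<noteq> {}" for A :: "(real^'a) set"
  proof -
    note cA = closed_hull_properties[OF that refl]
    have "0 \<le> err2 (av (closure (convex hull A))) T n \<and>
        err2 (av (closure (convex hull A))) T n \<le> err2 (av A) T n" if T: "test_seq T" and n: "0 < n" for T n
    proof
      show "0 \<le> err2 (av (closure (convex hull A))) T n"
        by (rule err2_nonneg[where R = "av (closure (convex hull A))" and n = n,
              OF T av_states[OF cA(4) n] av_nonempty[OF cA(3)]])
      show "err2 (av (closure (convex hull A))) T n \<le> err2 (av A) T n"
        by (rule err2_le[where R = "av (closure (convex hull A))" and n = n, OF av_nonempty[OF cA(3)]],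
            rule expect_av_closed_hull_le[OF expect_le_err2])
           (use T av_states[OF \<open>A \<subseteq> states\<close> n] in auto)
    qed
    then show ?thesis by (simp add: dominated_def)
  qed
  show "e_adv e coR coS \<le> e_adv e R S"
    unfolding e_adv_def by (intro mono d_adv cR cS R S)
  show "e_adv e R S \<le> e_av e R S"
    unfolding e_adv_def e_av_def by (intro mono d_av_adv R S)
  have "e_av e coR coS \<le> e_av e R S"
    unfolding e_av_def by (intro mono d_av cR cS R S)
  moreover have "e_av e R S \<le> e_av e coR coS"
    unfolding e_av_def coR coS by (intro mono d_hull R S)
  ultimately show "e_av e R S = e_av e coR coS" by simp
  show "e_av e coR coS \<le> e_iid e coR coS"
    unfolding e_av_def e_iid_def by (intro mono d_iid_av cR cS)
  show "e_iid e coR coS \<le> e_relaxed {x} e coR coS" if "x \<in> {0, 1}"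
    using that unfolding e_relaxed_def e_iid_def
    by (auto intro!: mono d_iid d_single cR cS)
  show "e_relaxed {x} e coR coS \<le> e_relaxed {0, 1} e coR coS" if "x \<in> {0, 1}"
    using that unfolding e_relaxed_def
    by (auto intro!: mono d_singles d_single cR cS)
  show "e_relaxed {0, 1} e coR coS \<le> (INF \<rho>\<in>coR. INF \<sigma>\<in>coS. e_simple e \<rho> \<sigma>)"
    unfolding e_relaxed_def e_simple_def e_iid_def
    by (auto intro!: INF_greatest mono d_pick cR cS)
qed

theorem mainTheorem5:
  fixes R S coR coS :: "(real^'a::finite) set"
    and r :: real
    and e :: "'a exponent"
    and E :: "real^'a \<Rightarrow> real^'a \<Rightarrow> ereal"
  assumes "R \<subseteq> states" "R \<noteq> {}"
    and "S \<subseteq> states" "S \<noteq> {}"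
    and coR: "coR = closure (convex hull R)"
    and coS: "coS = closure (convex hull S)"
    and "0 < r"
    and "(e, E) \<in> {(stein_exp, relative_entropy), (chernoff_exp, chernoff_div),
                   (direct_exp r, hoeffding_div r)}"
  shows
    (* the case excluded in the first equality is explained at renyi_div_0 *)
    "(\<not> ((e, E) = (direct_exp r, hoeffding_div r) \<and> ereal r = set_div renyi_div_0 coR coS) \<longrightarrow>
        set_div E coR coS = (INF \<rho>\<in>coR. INF \<sigma>\<in>coS. e_simple e \<rho> \<sigma>))
     \<and> (INF \<rho>\<in>coR. INF \<sigma>\<in>coS. e_simple e \<rho> \<sigma>) \<le> e_adv e coR coS
     \<and> e_adv e coR coS \<le> e_adv e R S
     \<and> e_adv e R S \<le> e_av e R S
     \<and> e_av e R S = e_av e coR coS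
     \<and> e_av e coR coS \<le> e_iid e coR coS
     \<and> (\<forall>x\<in>{0, 1}. e_iid e coR coS \<le> e_relaxed {x} e coR coS
                  \<and> e_relaxed {x} e coR coS \<le> e_relaxed {0, 1} e coR coS)
     \<and> e_relaxed {0, 1} e coR coS \<le> (INF \<rho>\<in>coR. INF \<sigma>\<in>coS. e_simple e \<rho> \<sigma>)
     \<and> (\<forall>v\<in>{e_adv e coR coS, e_adv e R S, e_av e R S, e_av e coR coS, e_iid e coR coS,
              e_relaxed {0} e coR coS, e_relaxed {1} e coR coS, e_relaxed {0, 1} e coR coS}.
          v = (INF \<rho>\<in>coR. INF \<sigma>\<in>coS. e_simple e \<rho> \<sigma>))"
proof -
  define V where "V = (INF \<rho>\<in>coR. INF \<sigma>\<in>coS. e_simple e \<rho> \<sigma>)"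
  note cR = closed_hull_properties[OF assms(1,2) coR] and cS = closed_hull_properties[OF assms(3,4) coS]
  have mono: "monotone_exponent e"
    using assms(8) monotone_stein_exp monotone_chernoff_exp monotone_direct_exp by auto
  note chain = exponent_chain[OF assms(1-6) mono, folded V_def]
  have div_le: "set_div E coR coS \<le> e_adv e coR coS"
    using assms(8) set_div_le_adv[OF cR(1-4) cS(1-4)] by auto
  have le_div: "V \<le> set_div E coR coS"
    if ne: "\<not> ((e, E) = (direct_exp r, hoeffding_div r) \<and> ereal r = set_div renyi_div_0 coR coS)"
    unfolding V_def
  proof (rule INF_simple_le_set_div)
    fix \<rho> \<sigma> assume mem: "\<rho> \<in> coR" "\<sigma> \<in> coS"
    then have st: "\<rho> \<in> states" "\<sigma> \<in> states" using cR(4) cS(4) by auto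
    consider "e = stein_exp" "E = relative_entropy" | "e = chernoff_exp" "E = chernoff_div"
      | "e = direct_exp r" "E = hoeffding_div r" using assms(8) by auto
    then show "(INF \<rho>\<in>coR. INF \<sigma>\<in>coS. e_simple e \<rho> \<sigma>) \<le> E \<rho> \<sigma>"
    proof cases
      case 1
      then show ?thesis using INF2_lower[OF mem] stein_exp_simple_le[OF st] order_trans by blast
    next
      case 2
      then show ?thesis using INF2_lower[OF mem] chernoff_exp_simple_le[OF st] order_trans by blast
    next
      case 3
      then show ?thesis using INF_direct_exp_le_hoeffding[OF cR(2,4) cS(2,4) _ mem] ne by simp
    qed
  qed
  have V_le: "V \<le> e_adv e coR coS"
  proof (cases "(e, E) = (direct_exp r, hoeffding_div r) \<and> ereal r = set_div renyi_div_0 coR coS")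
    case True
    then show ?thesis using direct_exp_adv_exceptional[OF cR(2-4) cS(3,4), of r] by simp
  next
    case False
    then show ?thesis using le_div div_le by simp
  qed
  have relaxed: "e_iid e coR coS \<le> e_relaxed {x} e coR coS"
    "e_relaxed {x} e coR coS \<le> e_relaxed {0, 1} e coR coS" if "x \<in> {0, 1}" for x
    using chain(5,6) that by auto
  \<comment> \<open>The chain starts and ends at \<open>V\<close>, so everything in between equals
    \<open>V\<close>.\<close>
  have eqs: "\<forall>v\<in>{e_adv e coR coS, e_adv e R S, e_av e R S, e_av e coR coS, e_iid e coR coS,
              e_relaxed {0} e coR coS, e_relaxed {1} e coR coS, e_relaxed {0, 1} e coR coS}. v = V"
    using V_le chain(1-4,7) relaxed[of 0] relaxed[of 1] by auto
  have "set_div E coR coS = V"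
    if "\<not> ((e, E) = (direct_exp r, hoeffding_div r) \<and> ereal r = set_div renyi_div_0 coR coS)"
    using le_div[OF that] div_le eqs by auto
  then show ?thesis
    unfolding V_def[symmetric] using V_le chain relaxed eqs by blast
qed

end
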